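(* \textsc{Cluster Deletion} can be solved in $\mathcal{O}(9^{\ell}\cdot \ell n)$ time, where $n$ is the number of vertices of the input graph and $\ell:=|E|-k$.
   Context: All graphs are finite, undirected and simple. A cluster graph is a disjoint union of cliques. \textsc{Cluster Deletion}: given a graph $G=(V,E)$ and $k\in\mathbb{N}$, decide whether $G$ can be transformed into a cluster graph by deleting at most $k$ edges; equivalently, whether $G$ has a cluster subgraph with at least $\ell=|E|-k$ edges. *)

theory Defs
  imports Main "HOL-Library.Disjoint_Sets"
begin

section \<open>Cluster Deletion\<close>

definition simple_graph :: "'a set \<Rightarrow> 'a set set \<Rightarrow> bool" where
  "simple_graph V E \<longleftrightarrow> finite V \<and> (\<forall>e\<in>E. e \<subseteq> V \<and> card e = 2)"

text \<open>A disjoint union of cliques: the vertex set is partitioned into the vertex sets of the cliques.\<close>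

definition cluster_graph :: "'a set \<Rightarrow> 'a set set \<Rightarrow> bool" where
  "cluster_graph V E \<longleftrightarrow>
     (\<exists>P. partition_on V P \<and> E = {{u, v} | u v. u \<noteq> v \<and> (\<exists>K\<in>P. u \<in> K \<and> v \<in> K)})"

definition cluster_deletion :: "'a set \<Rightarrow> 'a set set \<Rightarrow> nat \<Rightarrow> bool" where
  "cluster_deletion V E k \<longleftrightarrow> (\<exists>D\<subseteq>E. card D \<le> k \<and> cluster_graph V (E - D))"

section \<open>A random access machine\<close>

text \<open>
  A program uses finitely many registers and a memory with indirect addressing; both hold natural
  numbers. Arithmetic is restricted to addition and truncated subtraction. Control flow is
  structured, which agrees with jumps up to a constant factor in the running time.
\<close>

type_synonym reg = nat

datatype com =
    Const reg nat
  | Copy reg reg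
  | Add reg reg reg
  | Sub reg reg reg
  | Load reg reg
  | Store reg reg
  | Skip
  | Seq com com
  | IfLess reg reg com com
  | WhileLess reg reg com

type_synonym state = "(reg \<Rightarrow> nat) \<times> (nat \<Rightarrow> nat)"

text \<open>
  \<open>exec W p s t s'\<close>: with words holding the numbers below \<open>W\<close>, program \<open>p\<close> started in \<open>s\<close> halts
  in \<open>s'\<close> after \<open>t\<close> steps. Every elementary instruction and every evaluation of a test takes one
  step. There is no transition for an instruction that overflows, so a derivation of \<open>exec\<close> entails
  that no overflow occurs. Only \<open>Const\<close> and \<open>Add\<close> can create a number larger than those already
  present.
\<close>

inductive exec :: "nat \<Rightarrow> com \<Rightarrow> state \<Rightarrow> nat \<Rightarrow> state \<Rightarrow> bool" for W :: nat where
  Const: "a < W \<Longrightarrow> exec W (Const x a) (r, m) 1 (r(x := a), m)"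
| Copy: "exec W (Copy x y) (r, m) 1 (r(x := r y), m)"
| Add: "r y + r z < W \<Longrightarrow> exec W (Add x y z) (r, m) 1 (r(x := r y + r z), m)"
| Sub: "exec W (Sub x y z) (r, m) 1 (r(x := r y - r z), m)"
| Load: "exec W (Load x y) (r, m) 1 (r(x := m (r y)), m)"
| Store: "exec W (Store x y) (r, m) 1 (r, m(r x := r y))"
| Skip: "exec W Skip s 1 s"
| Seq: "exec W p s t s' \<Longrightarrow> exec W q s' u s'' \<Longrightarrow> exec W (Seq p q) s (t + u) s''"
| IfTrue: "fst s x < fst s y \<Longrightarrow> exec W p s t s' \<Longrightarrow> exec W (IfLess x y p q) s (1 + t) s'"
| IfFalse: "\<not> fst s x < fst s y \<Longrightarrow> exec W q s t s' \<Longrightarrow> exec W (IfLess x y p q) s (1 + t) s'"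
| WhileTrue: "fst s x < fst s y \<Longrightarrow> exec W p s t s' \<Longrightarrow> exec W (WhileLess x y p) s' u s''
    \<Longrightarrow> exec W (WhileLess x y p) s (1 + t + u) s''"
| WhileFalse: "\<not> fst s x < fst s y \<Longrightarrow> exec W (WhileLess x y p) s 1 s"

inductive_cases exec_ConstE: "exec W (Const x a) s t s'"
inductive_cases exec_CopyE: "exec W (Copy x y) s t s'"
inductive_cases exec_AddE: "exec W (Add x y z) s t s'"
inductive_cases exec_SubE: "exec W (Sub x y z) s t s'"
inductive_cases exec_LoadE: "exec W (Load x y) s t s'"
inductive_cases exec_StoreE: "exec W (Store x y) s t s'"
inductive_cases exec_SkipE: "exec W Skip s t s'"
inductive_cases exec_SeqE: "exec W (Seq p q) s t s'"
inductive_cases exec_IfLessE: "exec W (IfLess x y p q) s t s'"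
inductive_cases exec_WhileLessE: "exec W (WhileLess x y p) s t s'"

lemma exec_deterministic:
  "exec W p s t s' \<Longrightarrow> exec W p s u s'' \<Longrightarrow> t = u \<and> s' = s''"
proof (induction arbitrary: u s'' rule: exec.induct)
  case Const
  from Const.prems show ?case by (rule exec_ConstE) simp
next
  case Copy
  from Copy.prems show ?case by (rule exec_CopyE) simp
next
  case Add
  from Add.prems show ?case by (rule exec_AddE) simp
next
  case Sub
  from Sub.prems show ?case by (rule exec_SubE) simp
next
  case Load
  from Load.prems show ?case by (rule exec_LoadE) simp
next
  case Store
  from Store.prems show ?case by (rule exec_StoreE) simp
next
  case Skip
  from Skip.prems show ?case by (rule exec_SkipE) simp
next
  case (Seq p s t s' q v s3)
  from Seq.prems obtain t1 s1 t2 where "u = t1 + t2" "exec W p s t1 s1" "exec W q s1 t2 s''"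
    by (rule exec_SeqE)
  moreover from this(2) have "t = t1 \<and> s' = s1"
    by (rule Seq.IH(1))
  ultimately show ?case
    using Seq.IH(2) by simp
next
  case (IfTrue s x y p t s' q)
  from IfTrue.prems obtain t1 where "u = 1 + t1" "exec W p s t1 s''"
    by (rule exec_IfLessE) (use IfTrue.hyps(1) in simp_all)
  with IfTrue.IH show ?case by simp
next
  case (IfFalse s x y q t s' p)
  from IfFalse.prems obtain t1 where "u = 1 + t1" "exec W q s t1 s''"
    by (rule exec_IfLessE) (use IfFalse.hyps(1) in simp_all)
  with IfFalse.IH show ?case by simp
next
  case (WhileTrue s x y p t s' v s3)
  from WhileTrue.prems obtain t1 s1 t2 where
    "u = 1 + t1 + t2" "exec W p s t1 s1" "exec W (WhileLess x y p) s1 t2 s''"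
    by (rule exec_WhileLessE) (use WhileTrue.hyps(1) in simp_all)
  moreover from this(2) have "t = t1 \<and> s' = s1"
    by (rule WhileTrue.IH(1))
  ultimately show ?case
    using WhileTrue.IH(2) by simp
next
  case (WhileFalse s x y p)
  from WhileFalse.prems show ?case
    by (rule exec_WhileLessE) (use WhileFalse.hyps in simp_all)
qed

section \<open>Encoding of the input\<close>

text \<open>Adjacency lists of a graph on the vertices \<open>0, \<dots>, n - 1\<close>; each list may be in any order.\<close>

definition adjacency_lists :: "nat \<Rightarrow> nat set set \<Rightarrow> nat list list \<Rightarrow> bool" where
  "adjacency_lists n E adj \<longleftrightarrow>
     length adj = n \<and> (\<forall>v<n. distinct (adj ! v) \<and> set (adj ! v) = {u. {v, u} \<in> E})"

text \<open>
  The input consists of \<open>n\<close>, \<open>|E|\<close>, \<open>k\<close>, then for each vertex the address at which its adjacency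
  list starts (followed by the end address of the last list), then the adjacency lists themselves,
  stored contiguously from address \<open>n + 4\<close>.
\<close>

definition input_words :: "nat \<Rightarrow> nat set set \<Rightarrow> nat \<Rightarrow> nat list list \<Rightarrow> nat list" where
  "input_words n E k adj =
     [n, card E, k] @ map (\<lambda>v. n + 4 + length (concat (take v adj))) [0..<n + 1] @ concat adj"

definition initial_state :: "nat list \<Rightarrow> state" where
  "initial_state ws = ((\<lambda>_. 0), (\<lambda>a. if a < length ws then ws ! a else 0))"

text \<open>
  Words of \<open>O(l + log (n + k))\<close> bits. Since \<open>k < |E| \<le> n\<^sup>2\<close> on nontrivial instances, this is
  proportional to the logarithm of the running time \<open>9\<^sup>l l n\<close> there.
\<close>

definition word_bound :: "nat \<Rightarrow> nat \<Rightarrow> nat \<Rightarrow> nat \<Rightarrow> nat" where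
  "word_bound c n k l = (2 ^ l * (n + k + 2)) ^ c"

text \<open>
  \<open>solves_cluster_deletion p c T\<close>: on every instance, \<open>p\<close> halts within \<open>T n (|E| - k)\<close> steps with
  the answer in register \<open>0\<close>. The subtraction is truncated, so \<open>|E| - k = 0\<close> for the trivial
  instances with \<open>k \<ge> |E|\<close>.
\<close>

definition solves_cluster_deletion :: "com \<Rightarrow> nat \<Rightarrow> (nat \<Rightarrow> nat \<Rightarrow> nat) \<Rightarrow> bool" where
  "solves_cluster_deletion p c T \<longleftrightarrow>
     (\<forall>n E k adj. simple_graph {..<n} E \<longrightarrow> adjacency_lists n E adj \<longrightarrow>
        (\<exists>t s. exec (word_bound c n k (card E - k)) p (initial_state (input_words n E k adj)) t s \<and>
               t \<le> T n (card E - k) \<and>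
               fst s 0 = (if cluster_deletion {..<n} E k then 1 else 0)))"

end

theory Submission
  imports Defs "HOL-Library.Nat_Bijection"
begin

text \<open>
  A greedy maximal matching either reaches \<open>l\<close> edges, and is then itself a cluster subgraph with \<open>l\<close>
  edges, or its at most \<open>2 l - 2\<close> endpoints \<open>X\<close> form a vertex cover. In the latter case every cluster
  contains at most one vertex outside of \<open>X\<close>, so it is determined by its leader and its trace on \<open>X\<close>.
  A dynamic program over the leaders maximises the number of edges within every \<open>S \<subseteq> X\<close>; one round
  takes the maximum over all pairs of disjoint subsets of \<open>X\<close>, of which there are
  \<open>3 ^ card X \<le> 9 ^ l\<close>.

  Lacking bit operations, the program tabulates all pairs \<open>(A, B)\<close> of disjoint subsets, encoded as
  numbers. Then \<open>A + B\<close> is the code of the union, and \<open>A \<subseteq> N\<close> is detected by an entry with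
  \<open>A + B = N\<close>.
\<close>

section \<open>Cluster subgraphs and the dynamic program\<close>

text \<open>The adjacency lists can have total length of order \<open>n * n\<close>, so for small
  \<open>l\<close> there is no time to read all of them. This shapes every phase. While matching, a
  list is left at the first unmatched neighbour, and at most \<open>2 * l - 2\<close> matched ones
  precede it. In the rounds only vertices outside of the cover read their lists, all of whose
  entries lie in the cover. Long lists are read in full only for the clique test, once for each of
  the fewer than \<open>2 * l\<close> cover vertices. Thus reading costs a multiple of
  \<open>l * n\<close>. The sweeps cost \<open>n * 3 ^ x\<close> for the rounds and
  \<open>x * 3 ^ x\<close> for the clique test, where \<open>x\<close> is the size of the cover.

  A cluster with a vertex outside of the cover is led by that vertex. A cluster inside of the cover
  has no such vertex and is led by one of its own members; hence the rounds run over all vertices,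
  and a cover vertex accepts every clique of the cover.\<close>

definition clique_edges :: "'a set \<Rightarrow> 'a set set" where
  "clique_edges K = {e. e \<subseteq> K \<and> card e = 2}"

lemma finite_clique_edges [simp]: "finite K \<Longrightarrow> finite (clique_edges K)"
  unfolding clique_edges_def by (rule finite_subset[of _ "Pow K"]) auto

lemma card_clique_edges: "finite K \<Longrightarrow> card (clique_edges K) = card K choose 2"
  unfolding clique_edges_def by (rule n_subsets)

lemma clique_edges_disjoint: "K \<inter> L = {} \<Longrightarrow> clique_edges K \<inter> clique_edges L = {}"
proof -
  assume "K \<inter> L = {}"
  then have "card e = 0" if "e \<subseteq> K" "e \<subseteq> L" for e
    using that by (metis card.empty inf.bounded_iff subset_empty)
  then show ?thesis
    unfolding clique_edges_def by (metis (mono_tags, lifting) disjoint_iff mem_Collect_eq zero_neq_numeral)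
qed

lemma doubleton_in_clique_edges [simp]: "{u, v} \<in> clique_edges K \<longleftrightarrow> u \<noteq> v \<and> u \<in> K \<and> v \<in> K"
  unfolding clique_edges_def by (auto simp: card_insert_if)

lemma clique_edges_subset_iff:
  "clique_edges K \<subseteq> E \<longleftrightarrow> (\<forall>u\<in>K. \<forall>v\<in>K. u \<noteq> v \<longrightarrow> {u, v} \<in> E)"
proof
  assume "\<forall>u\<in>K. \<forall>v\<in>K. u \<noteq> v \<longrightarrow> {u, v} \<in> E"
  then show "clique_edges K \<subseteq> E"
    unfolding clique_edges_def by (auto simp: card_2_iff)
qed (auto simp: subset_iff)

lemma finite_edges: "simple_graph V E \<Longrightarrow> finite E"
  unfolding simple_graph_def by (auto intro: finite_subset[of E "Pow V"])

text \<open>Deleted are exactly the edges outside of the cliques, and the edge sets of distinct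
  classes are disjoint, whence the sum. For \<open>k\<close> above \<open>card E\<close> the
  truncated difference demands nothing, as it should.\<close>

lemma cluster_deletion_iff_partition:
  assumes "simple_graph V E"
  shows "cluster_deletion V E k \<longleftrightarrow>
    (\<exists>P. partition_on V P \<and> (\<Union>K\<in>P. clique_edges K) \<subseteq> E \<and> card E - k \<le> (\<Sum>K\<in>P. card K choose 2))"
proof -
  have fE: "finite E" by (rule finite_edges[OF assms])
  have *: "{{u, v} | u v. u \<noteq> v \<and> (\<exists>K\<in>P. u \<in> K \<and> v \<in> K)} = (\<Union>K\<in>P. clique_edges K)" for P :: "'a set set"
    unfolding clique_edges_def by (auto simp: card_2_iff)
  have card: "card (\<Union>K\<in>P. clique_edges K) = (\<Sum>K\<in>P. card K choose 2)" if "partition_on V P" for P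
  proof -
    have "finite V" using assms by (simp add: simple_graph_def)
    with that have fin: "finite P" "\<forall>K\<in>P. finite K"
      by (auto simp: partition_on_def intro: finite_UnionD finite_subset)
    have "disjoint P" using that by (simp add: partition_on_def)
    with fin have "card (\<Union>K\<in>P. clique_edges K) = (\<Sum>K\<in>P. card (clique_edges K))"
      by (intro card_UN_disjoint) (auto simp: disjoint_def clique_edges_disjoint)
    with fin show ?thesis by (simp add: card_clique_edges)
  qed
  show ?thesis
  proof
    assume "cluster_deletion V E k"
    then obtain D P where D: "D \<subseteq> E" "card D \<le> k" and P: "partition_on V P"
      and eq: "E - D = (\<Union>K\<in>P. clique_edges K)"
      unfolding cluster_deletion_def cluster_graph_def * by blast
    have "card E - k \<le> card (E - D)"
      using D fE by (simp add: card_Diff_subset finite_subset)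
    with P eq card[OF P] show "\<exists>P. partition_on V P \<and> (\<Union>K\<in>P. clique_edges K) \<subseteq> E \<and>
        card E - k \<le> (\<Sum>K\<in>P. card K choose 2)"
      by (intro exI[of _ P]) auto
  next
    assume "\<exists>P. partition_on V P \<and> (\<Union>K\<in>P. clique_edges K) \<subseteq> E \<and>
      card E - k \<le> (\<Sum>K\<in>P. card K choose 2)"
    then obtain P where P: "partition_on V P" and sub: "(\<Union>K\<in>P. clique_edges K) \<subseteq> E"
      and le: "card E - k \<le> (\<Sum>K\<in>P. card K choose 2)"
      by blast
    let ?F = "\<Union>K\<in>P. clique_edges K"
    have "card (E - ?F) = card E - card ?F"
      using sub fE by (intro card_Diff_subset) (auto intro: finite_subset)
    then have "card (E - ?F) \<le> k" using le card[OF P] by linarith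
    moreover have "E - (E - ?F) = ?F" using sub by blast
    ultimately show "cluster_deletion V E k"
      unfolding cluster_deletion_def cluster_graph_def * using P
      by (intro exI[of _ "E - ?F"]) auto
  qed
qed

text \<open>Uncovered vertices become singletons and empty members are dropped; neither affects the
  number of edges. An indexed family may repeat the empty set, as rounds without a cluster
  do.\<close>

lemma cluster_deletion_if_disjoint_cliques:
  assumes G: "simple_graph V E" and I: "finite I"
    and V: "\<And>i. i \<in> I \<Longrightarrow> C i \<subseteq> V" and E: "\<And>i. i \<in> I \<Longrightarrow> clique_edges (C i) \<subseteq> E"
    and disj: "\<And>i j. i \<in> I \<Longrightarrow> j \<in> I \<Longrightarrow> i \<noteq> j \<Longrightarrow> C i \<inter> C j = {}"
    and le: "card E - k \<le> (\<Sum>i\<in>I. card (C i) choose 2)"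
  shows "cluster_deletion V E k"
proof -
  let ?J = "{i \<in> I. C i \<noteq> {}}"
  let ?S = "(\<lambda>v. {v}) ` (V - \<Union> (C ` I))"
  let ?P = "C ` ?J \<union> ?S"
  have fV: "finite V" using G by (simp add: simple_graph_def)
  have part: "partition_on V ?P"
    unfolding partition_on_def disjoint_def using V disj by auto blast+
  have "clique_edges {v} = {}" for v :: 'a
    unfolding clique_edges_def by (auto simp: subset_singleton_iff)
  then have sub: "(\<Union>K\<in>?P. clique_edges K) \<subseteq> E"
    using E by auto
  have inj: "inj_on C ?J"
    using disj by (intro inj_onI) (metis (mono_tags, lifting) inf.idem mem_Collect_eq)
  have "(\<Sum>i\<in>I. card (C i) choose 2) = (\<Sum>i\<in>?J. card (C i) choose 2)"
    using I by (intro sum.mono_neutral_right) auto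
  also have "\<dots> = (\<Sum>K\<in>C ` ?J. card K choose 2)"
    by (simp add: sum.reindex[OF inj])
  also have "\<dots> \<le> (\<Sum>K\<in>?P. card K choose 2)"
    using I fV by (intro sum_mono2) auto
  finally show ?thesis
    using part sub le unfolding cluster_deletion_iff_partition[OF G] by (meson order_trans)
qed

text \<open>The vertices of the cover are listed as \<open>xs\<close>; subsets of the cover are represented by sets of
  positions in \<open>xs\<close>.\<close>

definition nbrs :: "nat set set \<Rightarrow> nat list \<Rightarrow> nat \<Rightarrow> nat set" where
  "nbrs E xs v = {i. i < length xs \<and> {v, xs ! i} \<in> E}"

text \<open>Stated row by row: the remaining elements lie in the neighbourhood of each element. One
  row is one subset test against a mask, which the table of pairs can answer.\<close>

definition clq :: "nat set set \<Rightarrow> nat list \<Rightarrow> nat set \<Rightarrow> bool" where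
  "clq E xs A \<longleftrightarrow> (\<forall>i\<in>A. A - {i} \<subseteq> nbrs E xs (xs ! i))"

text \<open>The number of edges of the cluster led by \<open>v\<close>, where a vertex outside of the cover joins
  its cluster \<open>A\<close>, while a vertex of the cover provides a slot for a cluster inside of the cover.\<close>

definition weight :: "nat set set \<Rightarrow> nat list \<Rightarrow> nat \<Rightarrow> nat set \<Rightarrow> nat" where
  "weight E xs v A =
     (if clq E xs A \<and> (v \<in> set xs \<or> A \<subseteq> nbrs E xs v)
      then (card A choose 2) + (if v \<in> set xs then 0 else card A) else 0)"

text \<open>Round \<open>v\<close> chooses the part \<open>A\<close> of the cover taken by the
  cluster of \<open>v\<close>. Inadmissible choices are not excluded but weigh 0, and
  \<open>A = {}\<close> lets \<open>v\<close> lead nothing.\<close>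

fun dp :: "nat set set \<Rightarrow> nat list \<Rightarrow> nat \<Rightarrow> nat set \<Rightarrow> nat" where
  "dp E xs 0 S = 0"
| "dp E xs (Suc v) S = Max ((\<lambda>A. dp E xs v (S - A) + weight E xs v A) ` Pow S)"

text \<open>Together with \<open>dp_ge\<close> this identifies \<open>dp\<close> as the maximal
  total weight of disjoint sets, one for each vertex below \<open>v\<close>: the best choice of the
  last round is added to a family for the rest of \<open>S\<close>.\<close>

lemma dp_attained:
  assumes "finite S"
  shows "\<exists>T. (\<forall>u<v. T u \<subseteq> S) \<and> (\<forall>u<v. \<forall>u'<v. u \<noteq> u' \<longrightarrow> T u \<inter> T u' = {}) \<and>
    dp E xs v S = (\<Sum>u<v. weight E xs u (T u))"
  using assms
proof (induction v arbitrary: S)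
  case (Suc v)
  let ?f = "\<lambda>A. dp E xs v (S - A) + weight E xs v A"
  have "Max (?f ` Pow S) \<in> ?f ` Pow S"
    using Suc.prems by (intro Max_in) auto
  then obtain A where A: "A \<subseteq> S" and max: "dp E xs (Suc v) S = ?f A"
    by auto
  from Suc.IH[of "S - A"] Suc.prems obtain T where T: "\<forall>u<v. T u \<subseteq> S - A"
    "\<forall>u<v. \<forall>u'<v. u \<noteq> u' \<longrightarrow> T u \<inter> T u' = {}"
    "dp E xs v (S - A) = (\<Sum>u<v. weight E xs u (T u))"
    by auto
  show ?case
  proof (intro exI conjI)
    show "\<forall>u<Suc v. (T(v := A)) u \<subseteq> S"
      using T(1) A by (auto simp: less_Suc_eq)
    show "\<forall>u<Suc v. \<forall>u'<Suc v. u \<noteq> u' \<longrightarrow> (T(v := A)) u \<inter> (T(v := A)) u' = {}"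
      using T(1,2) by (fastforce simp: less_Suc_eq)
    show "dp E xs (Suc v) S = (\<Sum>u<Suc v. weight E xs u ((T(v := A)) u))"
      unfolding max T(3) by simp
  qed
qed simp

lemma dp_ge:
  assumes "finite S" and "\<forall>u<v. T u \<subseteq> S" and "\<forall>u<v. \<forall>u'<v. u \<noteq> u' \<longrightarrow> T u \<inter> T u' = {}"
  shows "(\<Sum>u<v. weight E xs u (T u)) \<le> dp E xs v S"
  using assms
proof (induction v arbitrary: S)
  case (Suc v)
  have "(\<Sum>u<v. weight E xs u (T u)) \<le> dp E xs v (S - T v)"
  proof (rule Suc.IH)
    have "T u \<subseteq> S" "T u \<inter> T v = {}" if "u < v" for u
      using Suc.prems(2,3) that by simp_all
    then show "\<forall>u<v. T u \<subseteq> S - T v"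
      by blast
  qed (use Suc.prems in auto)
  then have "(\<Sum>u<Suc v. weight E xs u (T u)) \<le> dp E xs v (S - T v) + weight E xs v (T v)"
    by simp
  also have "\<dots> \<le> dp E xs (Suc v) S"
    unfolding dp.simps using Suc.prems by (intro Max_ge) auto
  finally show ?case .
qed simp

text \<open>A crude estimate suffices: it and \<open>dp_bound\<close> serve to exclude
  overflow.\<close>

lemma weight_bound: "A \<subseteq> {..<x} \<Longrightarrow> weight E xs v A \<le> 2 * 2 ^ x"
proof -
  assume "A \<subseteq> {..<x}"
  then have "card A \<le> x"
    using card_mono[of "{..<x}" A] by simp
  then have "(2::nat) ^ card A \<le> 2 ^ x"
    by (intro power_increasing) auto
  moreover have "card A < 2 ^ card A" "card A choose 2 \<le> 2 ^ card A"
    by (rule less_exp, rule binomial_le_pow2)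
  ultimately have "(card A choose 2) + card A \<le> 2 * 2 ^ x"
    by linarith
  then show ?thesis
    by (simp add: weight_def)
qed

lemma dp_bound: "S \<subseteq> {..<x} \<Longrightarrow> dp E xs v S \<le> v * (2 * 2 ^ x)"
proof (induction v arbitrary: S)
  case (Suc v)
  have fin: "finite S" using Suc.prems by (rule finite_subset) simp
  have "dp E xs v (S - A) + weight E xs v A \<le> Suc v * (2 * 2 ^ x)" if "A \<subseteq> S" for A
  proof -
    have "S - A \<subseteq> {..<x}" "A \<subseteq> {..<x}" using that Suc.prems by auto
    then have "dp E xs v (S - A) \<le> v * (2 * 2 ^ x)" "weight E xs v A \<le> 2 * 2 ^ x"
      using Suc.IH weight_bound by blast+
    then show ?thesis by simp
  qed
  with fin show ?case
    unfolding dp.simps by (intro Max.boundedI) auto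
qed simp

lemma edgeD:
  assumes "simple_graph V E" "{u, v} \<in> E"
  shows "u \<noteq> v" "u \<in> V" "v \<in> V"
  using assms unfolding simple_graph_def by (fastforce simp: card_insert_if)+

text \<open>A family of sets turns into clusters by adding each leader outside of the cover to its
  set. Conversely every cluster receives a leader, and disjoint clusters have different
  leaders.\<close>

lemma cluster_deletion_iff_dp:
  assumes G: "simple_graph {..<n} E" and xs: "distinct xs" "set xs \<subseteq> {..<n}"
    and cover: "\<And>u v. {u, v} \<in> E \<Longrightarrow> u \<in> set xs \<or> v \<in> set xs"
  shows "cluster_deletion {..<n} E k \<longleftrightarrow> card E - k \<le> dp E xs n {..<length xs}"
proof
  assume le: "card E - k \<le> dp E xs n {..<length xs}"
  obtain T where T: "\<forall>u<n. T u \<subseteq> {..<length xs}" and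
    disj: "\<forall>u<n. \<forall>u'<n. u \<noteq> u' \<longrightarrow> T u \<inter> T u' = {}" and
    dp: "dp E xs n {..<length xs} = (\<Sum>u<n. weight E xs u (T u))"
    using dp_attained[OF finite_lessThan, of n "length xs" E xs] by (elim exE conjE) (rule that)
  define good where "good u \<longleftrightarrow> clq E xs (T u) \<and> (u \<in> set xs \<or> T u \<subseteq> nbrs E xs u)" for u
  \<comment> \<open>An inadmissible pair yields the empty cluster, in accordance with its weight 0.
    A cover vertex \<open>u\<close> is a mere slot and is not added, for it may belong to the set of
    another leader.\<close>
  define C where "C u = (if good u then (!) xs ` T u \<union> (if u \<in> set xs then {} else {u}) else {})" for u
  have inj: "inj_on ((!) xs) {..<length xs}"
    using xs(1) by (auto simp: inj_on_def nth_eq_iff_index_eq)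
  have TX: "(!) xs ` T u \<subseteq> set xs" if "u < n" for u
    using T that by (force intro: nth_mem)
  show "cluster_deletion {..<n} E k"
  proof (rule cluster_deletion_if_disjoint_cliques[OF G, of "{..<n}" C])
    fix u assume "u \<in> {..<n}"
    then have u: "u < n" by simp
    show "C u \<subseteq> {..<n}"
      using TX[OF u] xs(2) u by (auto simp: C_def)
    show "clique_edges (C u) \<subseteq> E"
      using T u unfolding clique_edges_subset_iff
      by (auto simp: C_def good_def clq_def nbrs_def insert_commute split: if_splits)
    fix v assume "v \<in> {..<n}" "u \<noteq> v"
    then have v: "v < n" by simp
    have "T u \<inter> T v = {}" using disj u v \<open>u \<noteq> v\<close> by blast
    then have "(!) xs ` T u \<inter> (!) xs ` T v = {}"
      using inj T u v by (metis image_empty inj_on_image_Int)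
    then show "C u \<inter> C v = {}"
      using TX[OF u] TX[OF v] \<open>u \<noteq> v\<close> by (auto simp: C_def)
  next
    \<comment> \<open>A vertex joining a clique of size \<open>a\<close> adds \<open>a\<close> edges
      to its \<open>a choose 2\<close>.\<close>
    have "weight E xs u (T u) = card (C u) choose 2" if "u < n" for u
    proof -
      have fin: "finite (T u)" using T that finite_subset by blast
      have *: "card ((!) xs ` T u) = card (T u)"
        using inj T that by (intro card_image) (auto intro: inj_on_subset)
      show ?thesis
        using TX[OF that] fin
        by (auto simp: weight_def C_def good_def card_insert_if * numeral_2_eq_2)
    qed
    with le dp show "card E - k \<le> (\<Sum>u<n. card (C u) choose 2)" by simp
  qed simp
next
  assume "cluster_deletion {..<n} E k"
  then obtain P where P: "partition_on {..<n} P" and sub: "(\<Union>K\<in>P. clique_edges K) \<subseteq> E"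
    and le: "card E - k \<le> (\<Sum>K\<in>P. card K choose 2)"
    unfolding cluster_deletion_iff_partition[OF G] by blast
  \<comment> \<open>For a leader in the cover, \<open>weight\<close> counts only edges inside of the
    cover, so a vertex outside has to lead if there is one.\<close>
  define lead where "lead K = (if K \<subseteq> set xs then SOME v. v \<in> K else SOME v. v \<in> K - set xs)" for K
  define pos where "pos K = {i. i < length xs \<and> xs ! i \<in> K}" for K
  define T where "T v = (if \<exists>K\<in>P. v = lead K then pos (THE K. K \<in> P \<and> v \<in> K) else {})" for v
  have disjP: "K = L" if "K \<in> P" "L \<in> P" "v \<in> K" "v \<in> L" for K L v
    using P that by (auto simp: partition_on_def disjoint_def)
  have lead: "lead K \<in> K" "K \<subseteq> set xs \<or> lead K \<notin> set xs" if "K \<in> P" for K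
  proof -
    have "K \<noteq> {}" using P that by (auto simp: partition_on_def)
    then show "lead K \<in> K" "K \<subseteq> set xs \<or> lead K \<notin> set xs"
      unfolding lead_def using someI_ex[of "\<lambda>v. v \<in> K"] someI_ex[of "\<lambda>v. v \<in> K - set xs"]
      by auto
  qed
  have KV: "K \<subseteq> {..<n}" if "K \<in> P" for K
    using P that by (auto simp: partition_on_def)
  have T_lead: "T (lead K) = pos K" if "K \<in> P" for K
  proof -
    have "(THE L. L \<in> P \<and> lead K \<in> L) = K"
      using that lead(1)[OF that] disjP by (intro the_equality) auto
    with that show ?thesis by (auto simp: T_def)
  qed
  have T_other: "T v = {}" if "v \<notin> lead ` P" for v
    using that by (auto simp: T_def)
  have inj_lead: "inj_on lead P"
    using lead(1) disjP by (metis inj_onI)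
  have edge: "{u, v} \<in> E" if "K \<in> P" "u \<in> K" "v \<in> K" "u \<noteq> v" for K u v
    using sub that by (metis UN_subset_iff clique_edges_subset_iff)
  have weight: "card K choose 2 = weight E xs (lead K) (T (lead K))" if K: "K \<in> P" for K
  proof -
    have fin: "finite K" using KV[OF K] finite_subset by blast
    have bij: "bij_betw ((!) xs) (pos K) (K \<inter> set xs)"
      using xs(1) by (auto simp: bij_betw_def inj_on_def pos_def nth_eq_iff_index_eq in_set_conv_nth image_iff)
    then have card: "card (pos K) = card (K \<inter> set xs)" by (rule bij_betw_same_card)
    have clq: "clq E xs (pos K)"
      using edge[OF K] xs(1) by (auto simp: clq_def pos_def nbrs_def nth_eq_iff_index_eq)
    show ?thesis
    proof (cases "K \<subseteq> set xs")
      case True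
      then have "lead K \<in> set xs" using lead(1)[OF K] by blast
      moreover have "K \<inter> set xs = K" using True by blast
      ultimately show ?thesis using clq card by (simp add: weight_def T_lead[OF K])
    next
      case False
      then have notin: "lead K \<notin> set xs" using lead(2)[OF K] by blast
      \<comment> \<open>Two vertices of \<open>K\<close> outside of the cover would span an
        uncovered edge.\<close>
      have "K = insert (lead K) (K \<inter> set xs)"
        using cover edge[OF K _ lead(1)[OF K]] lead(1)[OF K] notin by auto
      then have "card K = Suc (card (K \<inter> set xs))"
        using notin fin by (metis IntD2 card_insert_disjoint finite_Int)
      moreover have "pos K \<subseteq> nbrs E xs (lead K)"
        using edge[OF K lead(1)[OF K]] notin nth_mem by (fastforce simp: pos_def nbrs_def)
      ultimately show ?thesis
        using clq card notin by (simp add: weight_def T_lead[OF K] numeral_2_eq_2)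
    qed
  qed
  have "card E - k \<le> (\<Sum>K\<in>P. weight E xs (lead K) (T (lead K)))"
    using le weight by simp
  also have "\<dots> = (\<Sum>v\<in>lead ` P. weight E xs v (T v))"
    by (simp add: sum.reindex[OF inj_lead])
  also have "\<dots> \<le> (\<Sum>v<n. weight E xs v (T v))"
    using KV lead(1) by (intro sum_mono2) auto
  also have "\<dots> \<le> dp E xs n {..<length xs}"
  proof (rule dp_ge)
    have "T v = {} \<or> (\<exists>K\<in>P. v = lead K \<and> T v = pos K)" for v
      by (metis T_lead T_other imageE)
    moreover have "pos K \<inter> pos L = {}" if "K \<in> P" "L \<in> P" "K \<noteq> L" for K L
      using disjP that by (auto simp: pos_def)
    ultimately have "T u \<inter> T v = {}" if "u \<noteq> v" for u v
      using that by (metis Int_empty_left Int_empty_right)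
    then show "\<forall>u<n. \<forall>u'<n. u \<noteq> u' \<longrightarrow> T u \<inter> T u' = {}"
      by blast
    show "\<forall>u<n. T u \<subseteq> {..<length xs}"
      by (auto simp: T_def pos_def)
  qed simp
  finally show "card E - k \<le> dp E xs n {..<length xs}" .
qed

section \<open>Pairs of disjoint subsets\<close>

definition extend :: "nat \<Rightarrow> nat set \<times> nat set \<Rightarrow> (nat set \<times> nat set) list" where
  "extend i = (\<lambda>(A, B). [(insert i A, B), (A, insert i B)])"

text \<open>Old entries stay in front, and each of them appends two new ones, with \<open>i\<close>
  on the left or on the right. With this order the machine can extend the table in place.\<close>

fun splits :: "nat \<Rightarrow> (nat set \<times> nat set) list" where
  "splits 0 = [({}, {})]"
| "splits (Suc i) = splits i @ concat (map (extend i) (splits i))"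

lemma length_extend: "length (concat (map (extend i) es)) = 2 * length es"
  by (induction es) (auto simp: extend_def)

lemma length_splits: "length (splits i) = 3 ^ i"
  by (induction i) (simp_all add: length_extend)

lemma set_splits: "set (splits i) = {(A, B). A \<inter> B = {} \<and> A \<union> B \<subseteq> {..<i}}"
proof (induction i)
  case (Suc i)
  have "(A, B) \<in> set (splits (Suc i)) \<longleftrightarrow> A \<inter> B = {} \<and> A \<union> B \<subseteq> {..<Suc i}" (is "?l \<longleftrightarrow> ?r") for A B
  proof
    assume ?l
    then show ?r
      using Suc.IH by (fastforce simp: extend_def)
  next
    assume r: ?r
    have in_iff: "(A', B') \<in> set (splits i) \<longleftrightarrow> A' \<inter> B' = {} \<and> A' \<union> B' \<subseteq> {..<i}" for A' B'
      using Suc.IH by auto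
    have ext: "(insert i A', B') \<in> set (splits (Suc i))" "(A', insert i B') \<in> set (splits (Suc i))"
      if "(A', B') \<in> set (splits i)" for A' B'
      using that by (force simp: extend_def)+
    consider "i \<in> A" "i \<notin> B" | "i \<in> B" "i \<notin> A" | "i \<notin> A" "i \<notin> B"
      using r by blast
    then show ?l
    proof cases
      case 1
      then have "(A - {i}, B) \<in> set (splits i)"
        unfolding in_iff using r by (auto simp: less_Suc_eq)
      from ext(1)[OF this] 1 show ?thesis by (simp add: insert_absorb)
    next
      case 2
      then have "(A, B - {i}) \<in> set (splits i)"
        unfolding in_iff using r by (auto simp: less_Suc_eq)
      from ext(2)[OF this] 2 show ?thesis by (simp add: insert_absorb)
    next
      case 3
      then have "A \<union> B \<subseteq> {..<i}"
        using r by (auto simp: less_Suc_eq subset_iff)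
      with r have "(A, B) \<in> set (splits i)" unfolding in_iff by blast
      then show ?thesis by simp
    qed
  qed
  then have "e \<in> set (splits (Suc i)) \<longleftrightarrow> e \<in> {(A, B). A \<inter> B = {} \<and> A \<union> B \<subseteq> {..<Suc i}}" for e
    by (cases e) (simp del: splits.simps)
  then show ?case by (rule set_eqI)
qed auto

lemma in_splits: "(A, B) \<in> set (splits i) \<longleftrightarrow> A \<inter> B = {} \<and> A \<union> B \<subseteq> {..<i}"
  by (simp add: set_splits)

lemma distinct_extend:
  assumes "distinct es" "\<forall>(A, B)\<in>set es. i \<notin> A \<and> i \<notin> B"
  shows "distinct (concat (map (extend i) es))"
  using assms
proof (induction es)
  case (Cons e es)
  obtain A B where e: "e = (A, B)" by force
  have "set (extend i e) \<inter> set (extend i e') = {}" if "e' \<in> set es" for e'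
  proof -
    obtain A' B' where e': "e' = (A', B')" by force
    have "(A, B) \<noteq> (A', B')" "i \<notin> A" "i \<notin> B" "i \<notin> A'" "i \<notin> B'"
      using Cons.prems that e e' by auto
    then show ?thesis
      unfolding e e' extend_def by (auto simp: insert_ident)
  qed
  moreover have "distinct (extend i e)"
    using Cons.prems by (auto simp: e extend_def)
  ultimately show ?case
    using Cons by auto
qed simp

text \<open>Every pair is visited only once, which the counting pass relies on.\<close>

lemma distinct_splits: "distinct (splits i)"
proof (induction i)
  case (Suc i)
  have notin: "\<forall>(A, B)\<in>set (splits i). i \<notin> A \<and> i \<notin> B"
    by (auto simp: set_splits)
  then have "set (splits i) \<inter> set (concat (map (extend i) (splits i))) = {}"
    by (fastforce simp: extend_def)
  with Suc distinct_extend[OF Suc notin] show ?case by simp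
qed simp

section \<open>Binary codes of sets, and the effect of one pass over the table\<close>

abbreviation enc :: "nat set \<Rightarrow> nat" where "enc \<equiv> set_encode"

text \<open>Disjoint sets share no binary digit, so the addition produces no carry.\<close>

lemma enc_union:
  assumes "A \<inter> B = {}" "A \<union> B \<subseteq> {..<x}"
  shows "enc A + enc B = enc (A \<union> B)"
proof -
  have "finite A" "finite B" using assms(2) finite_subset by auto
  with assms(1) show ?thesis
    by (simp add: set_encode_def sum.union_disjoint)
qed

lemma enc_eq_iff:
  assumes "A \<subseteq> {..<x}" "B \<subseteq> {..<y}"
  shows "enc A = enc B \<longleftrightarrow> A = B"
  using assms finite_subset by (intro set_encode_eq) blast+

lemma enc_full: "enc {..<x} = 2 ^ x - 1"
  by (induction x) (simp_all add: set_encode_def)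

lemma enc_less:
  assumes "A \<subseteq> {..<x}"
  shows "enc A < 2 ^ x"
proof -
  have "enc A \<le> enc {..<x}"
    unfolding set_encode_def using assms by (intro sum_mono2) auto
  then show ?thesis
    unfolding enc_full by (simp add: le_diff_conv2 Suc_le_eq)
qed

text \<open>Here \<open>N\<close> is to be the code of the neighbourhood of cover vertex
  \<open>i\<close>. An entry with union \<open>N\<close> presents a subset \<open>A\<close> of it.
  As \<open>i\<close> is not its own neighbour, \<open>enc A + 2 ^ i\<close> is the code of
  \<open>insert i A\<close>, whose row \<open>i\<close> thus passes the clique test.\<close>

definition count_step :: "nat \<Rightarrow> nat \<Rightarrow> nat set \<times> nat set \<Rightarrow> (nat \<Rightarrow> nat) \<Rightarrow> nat \<Rightarrow> nat" where
  "count_step i N = (\<lambda>(A, B) h. if enc A + enc B = N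
     then h(enc A + 2 ^ i := h (enc A + 2 ^ i) + 1) else h)"

text \<open>\<open>cnt (enc A) = card A\<close> is the clique test: every row of \<open>A\<close>
  has passed. The flag \<open>c\<close> says that the vertex of the round lies in the cover and
  brings no edges of its own.\<close>

definition weight_step ::
  "(nat \<Rightarrow> nat) \<Rightarrow> bool \<Rightarrow> nat \<Rightarrow> nat set \<times> nat set \<Rightarrow> (nat \<Rightarrow> nat) \<Rightarrow> nat \<Rightarrow> nat" where
  "weight_step cnt c N = (\<lambda>(A, B) h. if enc A + enc B = N \<and> cnt (enc A) = card A
     then h(enc A := (card A choose 2) + (if c then 0 else card A)) else h)"

definition max_step ::
  "(nat \<Rightarrow> nat) \<Rightarrow> (nat \<Rightarrow> nat) \<Rightarrow> nat set \<times> nat set \<Rightarrow> (nat \<Rightarrow> nat) \<Rightarrow> nat \<Rightarrow> nat" where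
  "max_step d w = (\<lambda>(A, B) h. h(enc A + enc B := max (h (enc A + enc B)) (d (enc B) + w (enc A))))"

text \<open>Every subset of the cover is the left part of some entry, so the pass reaches all of
  them; repetitions write the same value.\<close>

definition copy_step :: "(nat \<Rightarrow> nat) \<Rightarrow> nat set \<times> nat set \<Rightarrow> (nat \<Rightarrow> nat) \<Rightarrow> nat \<Rightarrow> nat" where
  "copy_step d = (\<lambda>(A, B) h. h(enc A := d (enc A)))"

lemma fold_take_Suc: "j < length es \<Longrightarrow> fold f (take (Suc j) es) h = f (es ! j) (fold f (take j es) h)"
  by (simp add: take_Suc_conv_app_nth)

lemma fold_count:
  assumes "i < x" "N \<subseteq> {..<x}" "i \<notin> N" "S \<subseteq> {..<x}"
  shows "fold (count_step i (enc N)) (splits x) h (enc S) =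
    h (enc S) + (if i \<in> S \<and> S - {i} \<subseteq> N then 1 else 0)"
proof -
  let ?P = "\<lambda>(A, B). A \<union> B = N \<and> insert i A = S"
  have *: "fold (count_step i (enc N)) es h (enc S) = h (enc S) + card {e \<in> set es. ?P e}"
    if "set es \<subseteq> set (splits x)" "distinct es" for es
    using that
  proof (induction es rule: rev_induct)
    case (snoc e es)
    obtain A B where e: "e = (A, B)" by force
    have AB: "A \<inter> B = {}" "A \<union> B \<subseteq> {..<x}"
      using snoc.prems(1) by (auto simp: e in_splits)
    have 1: "enc A + enc B = enc N \<longleftrightarrow> A \<union> B = N"
      unfolding enc_union[OF AB] using AB(2) assms(2) by (rule enc_eq_iff)
    have 2: "enc A + 2 ^ i = enc S \<longleftrightarrow> insert i A = S" if "A \<union> B = N"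
    proof -
      have "i \<notin> A" "finite A" using that assms(3) AB(2) finite_subset by blast+
      then have "enc A + 2 ^ i = enc (insert i A)" by simp
      moreover have "insert i A \<subseteq> {..<x}" using AB assms(1) by auto
      ultimately show ?thesis using enc_eq_iff[OF _ assms(4)] by simp
    qed
    have 3: "{e' \<in> set (es @ [e]). ?P e'} = (if ?P e then insert e {e' \<in> set es. ?P e'} else {e' \<in> set es. ?P e'})"
      by auto
    have 4: "e \<notin> {e' \<in> set es. ?P e'}" using snoc.prems(2) by auto
    have "finite {e' \<in> set es. ?P e'}" by simp
    from snoc 1 2 card_insert_disjoint[OF this 4] show ?case
      unfolding 3 by (auto simp: count_step_def e)
  qed simp
  \<comment> \<open>A single entry can raise the counter of \<open>S\<close>: its left part must be
    \<open>S - {i}\<close>, and its right part must complete this to \<open>N\<close>.\<close>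
  have "{e \<in> set (splits x). ?P e} = (if i \<in> S \<and> S - {i} \<subseteq> N then {(S - {i}, N - (S - {i}))} else {})"
    using assms by (auto simp: in_splits)
  with *[of "splits x"] distinct_splits show ?thesis by simp
qed

lemma fold_weight:
  assumes "N \<subseteq> {..<x}" "S \<subseteq> {..<x}"
  shows "fold (weight_step cnt c (enc N)) (splits x) h (enc S) =
    (if S \<subseteq> N \<and> cnt (enc S) = card S then (card S choose 2) + (if c then 0 else card S) else h (enc S))"
proof -
  have *: "fold (weight_step cnt c (enc N)) es h (enc S) =
    (if (\<exists>B. (S, B) \<in> set es \<and> S \<union> B = N) \<and> cnt (enc S) = card S
     then (card S choose 2) + (if c then 0 else card S) else h (enc S))"
    if "set es \<subseteq> set (splits x)" for es
    using that
  proof (induction es rule: rev_induct)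
    case (snoc e es)
    obtain A B where e: "e = (A, B)" by force
    have AB: "A \<inter> B = {}" "A \<union> B \<subseteq> {..<x}"
      using snoc.prems(1) by (auto simp: e in_splits)
    have 1: "enc A + enc B = enc N \<longleftrightarrow> A \<union> B = N"
      unfolding enc_union[OF AB] using AB(2) assms(1) by (rule enc_eq_iff)
    have 2: "enc A = enc S \<longleftrightarrow> A = S"
      using AB(2) assms(2) by (intro enc_eq_iff) auto
    have IH: "fold (weight_step cnt c (enc N)) es h (enc S) =
      (if (\<exists>B. (S, B) \<in> set es \<and> S \<union> B = N) \<and> cnt (enc S) = card S
       then (card S choose 2) + (if c then 0 else card S) else h (enc S))"
      using snoc by simp
    show ?case
    proof (cases "A = S \<and> A \<union> B = N")
      case True
      then have "\<exists>B'. (S, B') \<in> set (es @ [e]) \<and> S \<union> B' = N" using e by auto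
      moreover have "weight_step cnt c (enc N) e h' (enc S) = (if cnt (enc S) = card S
          then (card S choose 2) + (if c then 0 else card S) else h' (enc S))" for h'
      proof -
        have "A = S" "enc A + enc B = enc N" using True 1 by auto
        then show ?thesis by (simp add: weight_step_def e)
      qed
      moreover have "fold (weight_step cnt c (enc N)) (es @ [e]) h = weight_step cnt c (enc N) e (fold (weight_step cnt c (enc N)) es h)"
        by simp
      ultimately show ?thesis by (simp only: IH) simp
    next
      case False
      then have ex: "(\<exists>B'. (S, B') \<in> set (es @ [e]) \<and> S \<union> B' = N) \<longleftrightarrow>
          (\<exists>B'. (S, B') \<in> set es \<and> S \<union> B' = N)"
        using e by auto
      have "weight_step cnt c (enc N) e h' (enc S) = h' (enc S)" for h'
        using False 1 2 by (auto simp: weight_step_def e)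
      then have "fold (weight_step cnt c (enc N)) (es @ [e]) h (enc S) = fold (weight_step cnt c (enc N)) es h (enc S)"
        by simp
      then show ?thesis unfolding ex IH .
    qed
  qed simp
  have "(\<exists>B. (S, B) \<in> set (splits x) \<and> S \<union> B = N) \<longleftrightarrow> S \<subseteq> N"
  proof
    assume "S \<subseteq> N"
    then have "(S, N - S) \<in> set (splits x)" "S \<union> (N - S) = N"
      using assms by (auto simp: in_splits)
    then show "\<exists>B. (S, B) \<in> set (splits x) \<and> S \<union> B = N" by blast
  qed blast
  with *[of "splits x"] show ?thesis by simp
qed

lemma fold_copy:
  assumes "S \<subseteq> {..<x}"
  shows "fold (copy_step d) (splits x) h (enc S) = d (enc S)"
proof -
  have *: "fold (copy_step d) es h (enc S) = (if \<exists>B. (S, B) \<in> set es then d (enc S) else h (enc S))"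
    if "set es \<subseteq> set (splits x)" for es
    using that
  proof (induction es rule: rev_induct)
    case (snoc e es)
    obtain A B where e: "e = (A, B)" by force
    have "A \<subseteq> {..<x}"
      using snoc.prems(1) by (auto simp: e in_splits)
    then have "enc A = enc S \<longleftrightarrow> A = S"
      using assms by (rule enc_eq_iff)
    moreover have "fold (copy_step d) es h (enc S) = (if \<exists>B. (S, B) \<in> set es then d (enc S) else h (enc S))"
      using snoc by simp
    ultimately show ?case
      by (auto simp: copy_step_def e)
  qed simp
  have "(S, {}) \<in> set (splits x)" using assms by (simp add: in_splits)
  with *[of "splits x"] show ?thesis by auto
qed

text \<open>The entries with union \<open>S\<close> are the pairs \<open>(A, S - A)\<close>. The
  former content of the cell takes part in the maximum; \<open>dp_Suc_insert\<close> absorbs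
  it.\<close>

lemma fold_max:
  assumes "S \<subseteq> {..<x}"
  shows "fold (max_step d w) (splits x) h (enc S) =
    Max (insert (h (enc S)) ((\<lambda>A. d (enc (S - A)) + w (enc A)) ` Pow S))"
proof -
  let ?f = "\<lambda>(A, B). d (enc B) + w (enc A)"
  have *: "fold (max_step d w) es h (enc S) = Max (insert (h (enc S)) (?f ` {(A, B) \<in> set es. A \<union> B = S}))"
    if "set es \<subseteq> set (splits x)" for es
    using that
  proof (induction es rule: rev_induct)
    case (snoc e es)
    obtain A B where e: "e = (A, B)" by force
    have AB: "A \<inter> B = {}" "A \<union> B \<subseteq> {..<x}"
      using snoc.prems(1) by (auto simp: e in_splits)
    have 1: "enc A + enc B = enc S \<longleftrightarrow> A \<union> B = S"
      unfolding enc_union[OF AB] using AB(2) assms by (rule enc_eq_iff)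
    let ?Z = "insert (h (enc S)) (?f ` {(A, B) \<in> set es. A \<union> B = S})"
    have IH: "fold (max_step d w) es h (enc S) = Max ?Z"
      using snoc by simp
    have Z: "insert (h (enc S)) (?f ` {(A, B) \<in> set (es @ [e]). A \<union> B = S}) =
      (if A \<union> B = S then insert (?f e) ?Z else ?Z)"
      by (auto simp: e)
    have "finite {(A, B) \<in> set es. A \<union> B = S}"
      by (rule finite_subset[of _ "set es"]) auto
    then have fin: "finite ?Z" by simp
    show ?case
    proof -
      have "max_step d w e h' (enc S) = (if A \<union> B = S then max (h' (enc S)) (?f e) else h' (enc S))" for h'
        using 1 by (auto simp: max_step_def e)
      moreover have "fold (max_step d w) (es @ [e]) h = max_step d w e (fold (max_step d w) es h)"
        by simp
      moreover have "Max (insert (?f e) ?Z) = max (Max ?Z) (?f e)"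
        by (subst max.commute, rule Max_insert[OF fin]) simp
      ultimately show ?thesis
        unfolding Z by (cases "A \<union> B = S") (simp_all only: IH if_True if_False simp_thms)
    qed
  qed simp
  have "?f ` {(A, B) \<in> set (splits x). A \<union> B = S} = (\<lambda>A. d (enc (S - A)) + w (enc A)) ` Pow S"
    (is "?l = ?r")
  proof
    show "?l \<subseteq> ?r"
    proof
      fix y assume "y \<in> ?l"
      then obtain A B where AB: "A \<inter> B = {}" "A \<union> B = S" and y: "y = d (enc B) + w (enc A)"
        by (auto simp: in_splits)
      then have "B = S - A" "A \<in> Pow S" by blast+
      with y show "y \<in> ?r" by simp
    qed
    show "?r \<subseteq> ?l"
    proof
      fix y assume "y \<in> ?r"
      then obtain A where A: "A \<subseteq> S" "y = ?f (A, S - A)" by auto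
      then have "(A, S - A) \<in> {(A, B) \<in> set (splits x). A \<union> B = S}"
        using assms by (auto simp: in_splits)
      then show "y \<in> ?l" unfolding A(2) by (rule imageI)
    qed
  qed
  with *[of "splits x"] show ?thesis by simp
qed

section \<open>Weakest preconditions with running time\<close>

type_synonym pred = "nat \<Rightarrow> (nat \<Rightarrow> nat) \<Rightarrow> (nat \<Rightarrow> nat) \<Rightarrow> bool"

text \<open>Total correctness: halting, absence of overflow and the postcondition at once. The time
  \<open>t\<close> spent so far is an argument of the postcondition, so time bounds need no separate
  calculus.\<close>

definition wp :: "nat \<Rightarrow> com \<Rightarrow> pred \<Rightarrow> pred" where
  "wp W p Q t r m \<longleftrightarrow> (\<exists>t' r' m'. exec W p (r, m) t' (r', m') \<and> Q (t + t') r' m')"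

lemma wpI: "exec W p (r, m) t' (r', m') \<Longrightarrow> Q (t + t') r' m' \<Longrightarrow> wp W p Q t r m"
  unfolding wp_def by blast

text \<open>Determinism makes this an equivalence, so that straight-line code can be evaluated by
  rewriting.\<close>

lemma wp_exec: "exec W p (r, m) t' (r', m') \<Longrightarrow> wp W p Q t r m \<longleftrightarrow> Q (t + t') r' m'"
  unfolding wp_def by (metis exec_deterministic prod.inject)

lemma wpE:
  assumes "wp W p Q t r m"
  obtains t' r' m' where "exec W p (r, m) t' (r', m')" and "Q (t + t') r' m'"
  using assms unfolding wp_def by blast

lemma wp_mono: "wp W p Q t r m \<Longrightarrow> (\<And>t r m. Q t r m \<Longrightarrow> Q' t r m) \<Longrightarrow> wp W p Q' t r m"
  unfolding wp_def by blast

lemma wp_Const [simp]: "wp W (Const x a) Q t r m \<longleftrightarrow> a < W \<and> Q (t + 1) (r(x := a)) m"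
  by (metis wp_exec[OF exec.Const] wpE exec_ConstE prod.inject)

lemma wp_Copy [simp]: "wp W (Copy x y) Q t r m \<longleftrightarrow> Q (t + 1) (r(x := r y)) m"
  by (rule wp_exec[OF exec.Copy])

lemma wp_Add [simp]: "wp W (Add x y z) Q t r m \<longleftrightarrow> r y + r z < W \<and> Q (t + 1) (r(x := r y + r z)) m"
  by (metis wp_exec[OF exec.Add] wpE exec_AddE prod.inject)

lemma wp_Sub [simp]: "wp W (Sub x y z) Q t r m \<longleftrightarrow> Q (t + 1) (r(x := r y - r z)) m"
  by (rule wp_exec[OF exec.Sub])

lemma wp_Load [simp]: "wp W (Load x y) Q t r m \<longleftrightarrow> Q (t + 1) (r(x := m (r y))) m"
  by (rule wp_exec[OF exec.Load])

lemma wp_Store [simp]: "wp W (Store x y) Q t r m \<longleftrightarrow> Q (t + 1) r (m(r x := r y))"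
  by (rule wp_exec[OF exec.Store])

lemma wp_Skip [simp]: "wp W Skip Q t r m \<longleftrightarrow> Q (t + 1) r m"
  by (rule wp_exec[OF exec.Skip])

lemma wp_Seq [simp]: "wp W (Seq p q) Q t r m \<longleftrightarrow> wp W p (wp W q Q) t r m"
proof
  assume "wp W (Seq p q) Q t r m"
  then obtain t' r' m' where "exec W (Seq p q) (r, m) t' (r', m')" and Q: "Q (t + t') r' m'"
    unfolding wp_def by blast
  then obtain t1 s1 t2 where "t' = t1 + t2" "exec W p (r, m) t1 s1" "exec W q s1 t2 (r', m')"
    by (auto elim: exec_SeqE)
  with Q show "wp W p (wp W q Q) t r m"
    unfolding wp_def by (cases s1) (metis add.assoc)
next
  assume "wp W p (wp W q Q) t r m"
  then show "wp W (Seq p q) Q t r m"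
    unfolding wp_def by (metis add.assoc exec.Seq)
qed

lemma wp_IfLess [simp]:
  "wp W (IfLess x y p q) Q t r m \<longleftrightarrow>
     (if r x < r y then wp W p Q (t + 1) r m else wp W q Q (t + 1) r m)"
proof (cases "r x < r y")
  case True
  then have "exec W (IfLess x y p q) (r, m) t' s' \<longleftrightarrow> (\<exists>u. t' = 1 + u \<and> exec W p (r, m) u s')" for t' s'
    by (auto elim: exec_IfLessE intro: exec.IfTrue[where s = "(r, m)", simplified])
  with True show ?thesis
    unfolding wp_def by (auto simp: add.assoc) (metis add_Suc_right)+
next
  case False
  then have "exec W (IfLess x y p q) (r, m) t' s' \<longleftrightarrow> (\<exists>u. t' = 1 + u \<and> exec W q (r, m) u s')" for t' s'
    by (auto elim: exec_IfLessE intro: exec.IfFalse[where s = "(r, m)", simplified])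
  with False show ?thesis
    unfolding wp_def by (auto simp: add.assoc) (metis add_Suc_right)+
qed

text \<open>\<open>j\<close> counts the completed rounds and need not be stored in any register; its
  bound \<open>N\<close> supplies termination.\<close>

lemma wp_while:
  assumes "I (0::nat) t r m"
    and step: "\<And>j t r m. I j t r m \<Longrightarrow> r x < r y \<Longrightarrow> j < N \<and> wp W p (I (Suc j)) (t + 1) r m"
    and exit: "\<And>j t r m. I j t r m \<Longrightarrow> \<not> r x < r y \<Longrightarrow> Q (t + 1) r m"
  shows "wp W (WhileLess x y p) Q t r m"
proof -
  have "wp W (WhileLess x y p) Q t r m" if "I j t r m" for j t r m
    using that
  proof (induction "N - j" arbitrary: j t r m rule: less_induct)
    case less
    show ?case
    proof (cases "r x < r y")
      case True
      with step less.prems have j: "j < N" and "wp W p (I (Suc j)) (t + 1) r m"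
        by blast+
      then obtain t1 r1 m1 where 1: "exec W p (r, m) t1 (r1, m1)" and "I (Suc j) (t + 1 + t1) r1 m1"
        unfolding wp_def by blast
      with less.hyps[of "Suc j"] j have "wp W (WhileLess x y p) Q (t + 1 + t1) r1 m1"
        by simp
      then obtain t2 r2 m2 where 2: "exec W (WhileLess x y p) (r1, m1) t2 (r2, m2)"
        and Q: "Q (t + 1 + t1 + t2) r2 m2"
        unfolding wp_def by blast
      from exec.WhileTrue[OF _ 1 2] True have "exec W (WhileLess x y p) (r, m) (1 + t1 + t2) (r2, m2)"
        by simp
      then show ?thesis
        by (rule wpI) (use Q in \<open>simp add: add.assoc\<close>)
    next
      case False
      then have "exec W (WhileLess x y p) (r, m) 1 (r, m)"
        by (intro exec.WhileFalse) simp
      then show ?thesis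
        by (rule wpI) (use False exit less.prems in blast)
    qed
  qed
  with assms(1) show ?thesis by blast
qed

section \<open>Counted loops\<close>

definition for_loop :: "reg \<Rightarrow> reg \<Rightarrow> reg \<Rightarrow> com \<Rightarrow> com" where
  "for_loop one i lim p = Seq (Const i 0) (WhileLess i lim (Seq p (Add i i one)))"

text \<open>\<open>X\<close> contains the registers that the body may change, and \<open>K j\<close>
  is the cost of its round \<open>j\<close>. Test and increment add two steps per round,
  initialisation and last test two more. The invariant mentions the memory only, as the other
  registers keep their values.\<close>

lemma wp_for_loop:
  assumes one: "r one = 1" and lim: "r lim = N" and N: "N < W"
    and fresh: "i \<noteq> one" "i \<noteq> lim" "i \<notin> X" "one \<notin> X" "lim \<notin> X"
    and init: "I 0 m"
    and step: "\<And>j t' r' m'. \<lbrakk>j < N; I j m'; \<forall>x. x \<noteq> i \<longrightarrow> x \<notin> X \<longrightarrow> r' x = r x; r' i = j\<rbrakk> \<Longrightarrow>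
      wp W p (\<lambda>t'' r'' m''. t'' \<le> t' + K j \<and> I (Suc j) m'' \<and> (\<forall>x. x \<notin> X \<longrightarrow> r'' x = r' x)) t' r' m'"
    and exit: "\<And>t' r' m'. \<lbrakk>t' \<le> t + 2 + (\<Sum>j<N. K j + 2); I N m'; \<forall>x. x \<noteq> i \<longrightarrow> x \<notin> X \<longrightarrow> r' x = r x\<rbrakk>
      \<Longrightarrow> Q t' r' m'"
  shows "wp W (for_loop one i lim p) Q t r m"
proof -
  let ?I = "\<lambda>j t' r' m'. j \<le> N \<and> t' \<le> t + 1 + (\<Sum>j<j. K j + 2) \<and> I j m' \<and> r' i = j \<and>
    (\<forall>x. x \<noteq> i \<longrightarrow> x \<notin> X \<longrightarrow> r' x = r x)"
  have "wp W (WhileLess i lim (Seq p (Add i i one))) Q (t + 1) (r(i := 0)) m"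
  proof (rule wp_while[of ?I _ _ _ _ _ N])
    show "?I 0 (t + 1) (r(i := 0)) m"
      using init by simp
  next
    fix j t' r' m'
    assume I: "?I j t' r' m'" and "r' i < r' lim"
    with fresh lim have "j < N" by auto
    have "wp W p (\<lambda>t'' r'' m''. t'' \<le> t' + 1 + K j \<and> I (Suc j) m'' \<and> (\<forall>x. x \<notin> X \<longrightarrow> r'' x = r' x)) (t' + 1) r' m'"
      using I \<open>j < N\<close> by (intro step) auto
    then have "wp W (Seq p (Add i i one)) (?I (Suc j)) (t' + 1) r' m'"
      unfolding wp_Seq
    proof (rule wp_mono)
      fix t'' r'' m''
      assume "t'' \<le> t' + 1 + K j \<and> I (Suc j) m'' \<and> (\<forall>x. x \<notin> X \<longrightarrow> r'' x = r' x)"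
      with I \<open>j < N\<close> fresh one N show "wp W (Add i i one) (?I (Suc j)) t'' r'' m''"
        by auto
    qed
    with \<open>j < N\<close> show "j < N \<and> wp W (Seq p (Add i i one)) (?I (Suc j)) (t' + 1) r' m'" ..
  next
    fix j t' r' m'
    assume I: "?I j t' r' m'" and "\<not> r' i < r' lim"
    with fresh lim have "j = N" by auto
    with I show "Q (t' + 1) r' m'" by (intro exit) auto
  qed
  with N show ?thesis
    by (simp add: for_loop_def)
qed

section \<open>Memory layout\<close>

abbreviation (input) seq :: "com \<Rightarrow> com \<Rightarrow> com" (infixr ";;" 60) where "p ;; q \<equiv> Seq p q"

abbreviation (input) "rOne \<equiv> 2 :: reg"
abbreviation (input) "rZero \<equiv> 3 :: reg"
abbreviation (input) "rThree \<equiv> 4 :: reg"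
abbreviation (input) "rN \<equiv> 5 :: reg"
abbreviation (input) "rL \<equiv> 6 :: reg"
abbreviation (input) "rBase \<equiv> 7 :: reg"
abbreviation (input) "rP \<equiv> 8 :: reg"
abbreviation (input) "rC \<equiv> 9 :: reg"
abbreviation (input) "rV \<equiv> 10 :: reg"
abbreviation (input) "rLim \<equiv> 11 :: reg"
abbreviation (input) "rB \<equiv> 12 :: reg"
abbreviation (input) "rA \<equiv> 13 :: reg"
abbreviation (input) "rE \<equiv> 14 :: reg"
abbreviation (input) "rU \<equiv> 15 :: reg"
abbreviation (input) "rB2 \<equiv> 16 :: reg"
abbreviation (input) "rTm \<equiv> 17 :: reg"
abbreviation (input) "rTj \<equiv> 18 :: reg"
abbreviation (input) "rLen \<equiv> 19 :: reg"
abbreviation (input) "rLen0 \<equiv> 20 :: reg"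
abbreviation (input) "rI \<equiv> 21 :: reg"
abbreviation (input) "rT \<equiv> 22 :: reg"
abbreviation (input) "rX \<equiv> 23 :: reg"
abbreviation (input) "rS \<equiv> 24 :: reg"
abbreviation (input) "rC2 \<equiv> 25 :: reg"
abbreviation (input) "rSum \<equiv> 26 :: reg"
abbreviation (input) "rMask \<equiv> 27 :: reg"
abbreviation (input) "rQ \<equiv> 28 :: reg"
abbreviation (input) "rW \<equiv> 29 :: reg"
abbreviation (input) "rD \<equiv> 30 :: reg"
abbreviation (input) "rBB \<equiv> 31 :: reg"

definition field_address :: "nat \<Rightarrow> reg \<Rightarrow> com" where
  "field_address j x =
     Add rTm x x ;; Add rTm rTm rTm ;; Add rTm rTm rTm ;; Add rTm rTm rTm ;; Add rTm rTm rBase ;;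
     Const rTj j ;; Add rTm rTm rTj"

definition get :: "nat \<Rightarrow> reg \<Rightarrow> reg \<Rightarrow> com" where
  "get j d x = field_address j x ;; Load d rTm"

definition put :: "nat \<Rightarrow> reg \<Rightarrow> reg \<Rightarrow> com" where
  "put j x y = field_address j x ;; Store rTm y"

text \<open>The list starts are stored from address 3 on, so \<open>3 + v\<close> and
  \<open>4 + v\<close> hold the two ends of the list of \<open>v\<close>.\<close>

definition bounds :: com where
  "bounds = Add rA rThree rV ;; Add rE rA rOne ;; Load rA rA ;; Load rE rE"

text \<open>Once field 0 holds the cover weights, neighbours outside of the cover contribute 0, and
  the sum over the list is the code of the neighbours in the cover.\<close>

definition scan :: com where
  "scan = Const rMask 0 ;; bounds ;;
     WhileLess rA rE (Load rU rA ;; get 0 rB2 rU ;; Add rMask rMask rB2 ;; Add rA rA rOne)"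

lemma concat_nth_offset:
  "v < length xss \<Longrightarrow> j < length (xss ! v) \<Longrightarrow> concat xss ! (length (concat (take v xss)) + j) = xss ! v ! j"
proof (induction xss arbitrary: v)
  case (Cons xs xss)
  then show ?case by (cases v) (auto simp: nth_append)
qed simp

text \<open>The nontrivial instances. \<open>M\<close> is to bound all record indices (vertices,
  table entries, codes of subsets) and all numbers in the tables, including those accumulated over
  \<open>n\<close> rounds. The factor 16 in the bound on \<open>W\<close> is the record
  length.\<close>

locale machine_input =
  fixes n :: nat and E :: "nat set set" and k :: nat and adj :: "nat list list" and W :: nat
    and l M base :: nat
  assumes graph: "simple_graph {..<n} E"
    and adj: "adjacency_lists n E adj"
  defines "l \<equiv> card E - k" and "M \<equiv> 9 ^ l * (n + 1)" and "base \<equiv> n + 4 + length (concat adj)"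
  assumes W: "base + 16 * M + 16 \<le> W"
    and k: "k < card E"
begin

definition m0 :: "nat \<Rightarrow> nat" where
  "m0 = snd (initial_state (input_words n E k adj))"

definition start :: "nat \<Rightarrow> nat" where
  "start v = n + 4 + length (concat (take v adj))"

text \<open>
  Behind the input, the memory is an array of records of 16 words, whose field \<open>j\<close> at index \<open>i\<close> is
  \<open>F j i\<close>. Field 0 is indexed by vertices and holds the weight \<open>2 ^ i\<close> of the \<open>i\<close>-th cover vertex, or 0.
  Fields 9 (current round), 2 (next round), 3 (weight of a cluster) and 4 (clique test) are indexed
  by codes of subsets of the cover. Fields 5 to 8 describe the entry \<open>(A, B)\<close> of the table of pairs
  by the codes of \<open>A\<close> and \<open>B\<close>, \<open>card A\<close> and \<open>card A choose 2\<close>.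
\<close>

definition lay :: "(nat \<Rightarrow> nat \<Rightarrow> nat) \<Rightarrow> nat \<Rightarrow> nat" where
  "lay F a = (if a < base then m0 a else F ((a - base) mod 16) ((a - base) div 16))"

definition std :: "(reg \<Rightarrow> nat) \<Rightarrow> bool" where
  "std r \<longleftrightarrow> r rOne = 1 \<and> r rZero = 0 \<and> r rThree = 3 \<and> r rN = n \<and> r rL = l \<and> r rBase = base"

lemma n_less: "n < M"
proof -
  have "1 * (n + 1) \<le> 9 ^ l * (n + 1)" by (intro mult_right_mono) simp_all
  then show ?thesis by (simp add: M_def)
qed

lemma length_adj: "length adj = n"
  using adj by (simp add: adjacency_lists_def)

lemma length_input: "length (input_words n E k adj) = base"
  by (simp add: input_words_def base_def)

lemma m0_eq: "m0 a = (if a < base then input_words n E k adj ! a else 0)"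
  by (simp add: m0_def initial_state_def length_input)

text \<open>The memory behind the input starts as zero, so all tables begin as zero functions
  without any initialisation.\<close>

lemma lay_zero: "lay (\<lambda>_ _. 0) = m0"
  by (auto simp: lay_def m0_eq)

lemma start_n: "start n = base"
  by (simp add: start_def base_def length_adj)

lemma start_Suc: "v < n \<Longrightarrow> start (Suc v) = start v + length (adj ! v)"
  by (simp add: start_def take_Suc_conv_app_nth length_adj)

lemma start_mono: "u \<le> v \<Longrightarrow> v \<le> n \<Longrightarrow> start u \<le> start v"
  by (induction v rule: dec_induct) (simp_all add: start_Suc)

lemma lay_start: "v \<le> n \<Longrightarrow> lay F (3 + v) = start v"
  by (auto simp: lay_def m0_eq input_words_def base_def start_def nth_append nth_Cons' simp del: upt_Suc)

lemma lay_adj: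
  assumes "v < n" "j < length (adj ! v)"
  shows "start v + j < base" and "lay F (start v + j) = adj ! v ! j"
proof -
  have "start (Suc v) \<le> start n"
    using assms by (intro start_mono) auto
  then show *: "start v + j < base"
    using start_Suc[of v] start_n assms by simp
  have "input_words n E k adj ! (start v + j) = concat adj ! (length (concat (take v adj)) + j)"
    by (simp add: input_words_def start_def nth_append nth_Cons' del: upt_Suc)
  with * assms show "lay F (start v + j) = adj ! v ! j"
    by (simp add: lay_def m0_eq concat_nth_offset length_adj)
qed

lemma adj_less: "v < n \<Longrightarrow> u \<in> set (adj ! v) \<Longrightarrow> u < n"
  using adj edgeD[OF graph] by (auto simp: adjacency_lists_def)

lemma lay_field: "j < 16 \<Longrightarrow> lay F (base + 16 * i + j) = F j i"
  by (simp add: lay_def)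

text \<open>Division with remainder by 16 recovers field and index from the address, so a write
  affects no other cell. It lets programs be analysed on the functions \<open>F j\<close>
  alone.\<close>

lemma lay_upd:
  assumes "j < 16"
  shows "(lay F)(base + 16 * i + j := a) = lay (F(j := (F j)(i := a)))"
proof
  fix b
  show "((lay F)(base + 16 * i + j := a)) b = lay (F(j := (F j)(i := a))) b"
  proof (cases "b = base + 16 * i + j")
    case True
    with assms show ?thesis by (simp add: lay_def)
  next
    case False
    have "\<not> ((b - base) mod 16 = j \<and> (b - base) div 16 = i)" if "\<not> b < base"
    proof
      assume "(b - base) mod 16 = j \<and> (b - base) div 16 = i"
      then have "b - base = 16 * i + j"
        by (metis mult_div_mod_eq)
      with that False show False by simp
    qed
    with False show ?thesis by (auto simp: lay_def)
  qed
qed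

lemma wp_get:
  assumes "r rBase = base" "j < 16"
  shows "wp W (get j d x) Q t r (lay F) \<longleftrightarrow> base + 16 * r x + j < W \<and>
    Q (t + 8) (r(rTm := base + 16 * r x + j, rTj := j, d := F j (r x))) (lay F)"
proof -
  have *: "Suc (Suc (Suc (Suc (Suc (Suc (Suc (Suc t))))))) = t + 8" by simp
  have **: "r x + r x + (r x + r x) + (r x + r x + (r x + r x)) + (r x + r x + (r x + r x) + (r x + r x + (r x + r x))) = 16 * r x"
    by simp
  show ?thesis
    using assms by (auto simp: get_def field_address_def ** add.commute[of _ base] lay_field fun_upd_twist[of rTj rTm] *)
qed

lemma wp_put:
  assumes "r rBase = base" "j < 16" "y \<noteq> rTm" "y \<noteq> rTj"
  shows "wp W (put j x y) Q t r (lay F) \<longleftrightarrow> base + 16 * r x + j < W \<and>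
    Q (t + 8) (r(rTm := base + 16 * r x + j, rTj := j)) (lay (F(j := (F j)(r x := r y))))"
proof -
  have *: "Suc (Suc (Suc (Suc (Suc (Suc (Suc (Suc t))))))) = t + 8" by simp
  have **: "r x + r x + (r x + r x) + (r x + r x + (r x + r x)) + (r x + r x + (r x + r x) + (r x + r x + (r x + r x))) = 16 * r x"
    by simp
  show ?thesis
    using assms by (auto simp: put_def field_address_def ** add.commute[of _ base] lay_upd fun_upd_twist[of rTj rTm] *)
qed

lemmas wp_rw = wp_get wp_put

lemma wp_bounds:
  assumes "std r" "r rV = v" "v < n"
  shows "wp W bounds Q t r (lay F) \<longleftrightarrow> Q (t + 4) (r(rA := start v, rE := start (Suc v))) (lay F)"
proof -
  have *: "Suc (Suc (Suc (Suc t))) = t + 4" by simp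
  have "base \<ge> n + 4" by (simp add: base_def)
  with W assms show ?thesis
    using lay_start[of v F] lay_start[of "Suc v" F]
    by (simp add: bounds_def std_def fun_upd_twist[of rE rA] add.commute *)
qed

lemma wp_scan:
  assumes r: "std r" "r rV = v" "v < n"
    and bound: "sum_list (map (F 0) (adj ! v)) < W"
    and Q: "\<And>t' r'. \<lbrakk>t' \<le> t + 12 + 13 * length (adj ! v); r' rMask = sum_list (map (F 0) (adj ! v));
      \<forall>x. x \<notin> {rMask, rA, rE, rU, rB2, rTm, rTj} \<longrightarrow> r' x = r x\<rbrakk> \<Longrightarrow> Q t' r' (lay F)"
  shows "wp W scan Q t r (lay F)"
proof -
  let ?as = "adj ! v"
  let ?I = "\<lambda>j t' r' m'. m' = lay F \<and> j \<le> length ?as \<and> t' \<le> t + 10 + 13 * j \<and>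
    r' rA = start v + j \<and> r' rE = start v + length ?as \<and>
    r' rMask = sum_list (map (F 0) (take j ?as)) \<and>
    (\<forall>x. x \<notin> {rMask, rA, rE, rU, rB2, rTm, rTj} \<longrightarrow> r' x = r x)"
  let ?r = "r(rMask := 0, rA := start v, rE := start (Suc v))"
  have "wp W (WhileLess rA rE (Load rU rA ;; get 0 rB2 rU ;; Add rMask rMask rB2 ;; Add rA rA rOne)) Q
    (t + 5) ?r (lay F)"
  proof (rule wp_while[of ?I _ _ _ _ _ "length ?as"])
    show "?I 0 (t + 5) ?r (lay F)"
      using r by (simp add: start_Suc)
  next
    fix j t' r' m'
    assume I: "?I j t' r' m'" and "r' rA < r' rE"
    then have j: "j < length ?as" by simp
    let ?u = "?as ! j"
    have u: "?u < n" using adj_less[OF r(3)] j by simp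
    have "n < M" by (rule n_less)
    \<comment> \<open>A partial sum and its next summand stay within the total, which fits into a
      word by \<open>bound\<close>.\<close>
    have le: "sum_list (map (F 0) (take j ?as)) + F 0 ?u \<le> sum_list (map (F 0) ?as)"
    proof -
      have "?as = take j ?as @ ?u # drop (Suc j) ?as" using j by (simp add: id_take_nth_drop)
      then have "sum_list (map (F 0) ?as) = sum_list (map (F 0) (take j ?as @ ?u # drop (Suc j) ?as))"
        by simp
      then show ?thesis by simp
    qed
    show "j < length ?as \<and> wp W (Load rU rA ;; get 0 rB2 rU ;; Add rMask rMask rB2 ;; Add rA rA rOne)
      (?I (Suc j)) (t' + 1) r' m'"
      using I j u r W \<open>n < M\<close> le bound lay_adj[OF r(3) j]
      by (simp add: wp_rw std_def take_Suc_conv_app_nth)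
  next
    fix j t' r' m'
    assume I: "?I j t' r' m'" and "\<not> r' rA < r' rE"
    then have "j = length ?as" by simp
    with I show "Q (t' + 1) r' m'" by (auto intro!: Q)
  qed
  moreover have "0 < W" using W by simp
  moreover have "std (r(rMask := 0))" "(r(rMask := 0)) rV = v"
    using r by (simp_all add: std_def)
  ultimately show ?thesis
    using r(3) by (simp add: scan_def wp_bounds add.commute)
qed

end

section \<open>Sweeps over the table of pairs\<close>

definition entry_sum :: com where
  "entry_sum = get 5 rT rI ;; get 6 rX rI ;; Add rSum rT rX"

text \<open>The next free entry has index \<open>rLen0 + 2 * rI\<close>. Cardinality and number of
  pairs are updated by additions only: enlarging \<open>A\<close> by one element adds
  \<open>card A\<close> to \<open>card A choose 2\<close>.\<close>

definition extend_body :: com where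
  "extend_body =
     get 5 rT rI ;; get 6 rX rI ;; get 7 rS rI ;; get 8 rC2 rI ;;
     Add rLen rLen0 rI ;; Add rLen rLen rI ;;
     Add rD rT rBB ;; put 5 rLen rD ;; put 6 rLen rX ;;
     Add rD rS rOne ;; put 7 rLen rD ;; Add rD rC2 rS ;; put 8 rLen rD ;;
     Add rLen rLen rOne ;; Add rX rX rBB ;;
     put 5 rLen rT ;; put 6 rLen rX ;; put 7 rLen rS ;; put 8 rLen rC2"

text \<open>\<open>rP\<close> still holds \<open>2 ^ x\<close> from the matching, so the loop
  compares powers of two and \<open>x\<close> is never computed. Each round triples the
  length.\<close>

definition build_splits :: com where
  "build_splits = Const rBB 1 ;; Const rLen 1 ;;
     WhileLess rBB rP (Copy rLen0 rLen ;; for_loop rOne rI rLen0 extend_body ;;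
       Add rLen rLen0 rLen0 ;; Add rLen rLen rLen0 ;; Add rBB rBB rBB)"

text \<open>Codes are equal when both strict comparisons fail.\<close>

definition count_body :: com where
  "count_body = entry_sum ;; IfLess rSum rMask Skip (IfLess rMask rSum Skip
     (Add rSum rT rB ;; get 4 rQ rSum ;; Add rQ rQ rOne ;; put 4 rSum rQ))"

definition weight_body :: com where
  "weight_body = entry_sum ;; IfLess rSum rMask Skip (IfLess rMask rSum Skip
     (get 4 rQ rT ;; get 7 rS rI ;; IfLess rQ rS Skip (IfLess rS rQ Skip
       (get 8 rC2 rI ;; IfLess rZero rB Skip (Add rC2 rC2 rS) ;; put 3 rT rC2))))"

definition max_body :: com where
  "max_body = entry_sum ;; get 3 rW rT ;; get 9 rD rX ;; Add rW rD rW ;; get 2 rD rSum ;;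
     IfLess rD rW (put 2 rSum rW) Skip"

text \<open>The weights are reset as well: the next weight pass writes only the sets admissible for
  its vertex and relies on 0 elsewhere.\<close>

definition copy_body :: com where
  "copy_body = get 5 rT rI ;; get 2 rD rT ;; put 9 rT rD ;; put 3 rT rZero"

text \<open>Each entry increments at most one cell, by one. Holding for every cell, this keeps the
  counters within a word.\<close>

lemma fold_count_le: "fold (count_step i N) es h a \<le> h a + length es"
proof (induction es arbitrary: h)
  case (Cons e es)
  have "count_step i N e h a \<le> h a + 1"
    by (cases e) (simp add: count_step_def)
  with Cons[of "count_step i N e h"] show ?case by simp
qed simp

abbreviation (input) "scratch \<equiv> {rTm, rTj, rT, rX, rS, rC2, rSum, rQ, rW, rD}"

definition entries :: "(nat \<Rightarrow> nat \<Rightarrow> nat) \<Rightarrow> (nat set \<times> nat set) list \<Rightarrow> bool" where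
  "entries F es \<longleftrightarrow> (\<forall>j<length es. F 5 j = enc (fst (es ! j)) \<and> F 6 j = enc (snd (es ! j)) \<and>
     F 7 j = card (fst (es ! j)) \<and> F 8 j = card (fst (es ! j)) choose 2)"

text \<open>The cover will be the list of endpoints of a maximal matching with fewer than
  \<open>l\<close> edges, hence the strict bound on its length.\<close>

locale cover_input = machine_input n E k adj W
  for n :: nat and E :: "nat set set" and k :: nat and adj :: "nat list list" and W :: nat +
  fixes xs :: "nat list" and x :: nat
  assumes distinct_xs: "distinct xs" and xs_less: "set xs \<subseteq> {..<n}"
    and cover: "\<And>u v. {u, v} \<in> E \<Longrightarrow> u \<in> set xs \<or> v \<in> set xs"
    and length_xs: "length xs = x" and x_less: "x < 2 * l"
begin

lemma pow2_x: "2 * 2 ^ x \<le> M" "(2 * 2 ^ x) * (n + 1) \<le> M"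
proof -
  \<comment> \<open>The strictness of \<open>x < 2 * l\<close> pays for the additional factor
    2.\<close>
  have "(2::nat) ^ Suc x \<le> 2 ^ (2 * l)"
    using x_less by (intro power_increasing) auto
  also have "\<dots> = 4 ^ l"
    by (simp add: power_mult)
  also have "\<dots> \<le> 9 ^ l"
    by (intro power_mono) auto
  finally have *: "2 * 2 ^ x \<le> (9::nat) ^ l"
    by simp
  then show 2: "(2 * 2 ^ x) * (n + 1) \<le> M"
    unfolding M_def by (rule mult_right_mono) simp
  have "2 * 2 ^ x * 1 \<le> (2 * 2 ^ x) * (n + 1)"
    by (intro mult_left_mono) auto
  with 2 show "2 * 2 ^ x \<le> M" by linarith
qed

lemma pow3_x: "3 ^ x \<le> (9::nat) ^ l" "3 ^ x * (n + 1) \<le> M" "3 ^ x \<le> M"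
proof -
  have "(3::nat) ^ x \<le> 3 ^ (2 * l)"
    using x_less by (intro power_increasing) auto
  then show *: "3 ^ x \<le> (9::nat) ^ l"
    by (simp add: power_mult)
  then show 2: "3 ^ x * (n + 1) \<le> M"
    unfolding M_def by (rule mult_right_mono) simp
  have "3 ^ x * 1 \<le> 3 ^ x * (n + 1)"
    by (intro mult_left_mono) auto
  with 2 show "3 ^ x \<le> M" by linarith
qed

lemma choose_bound: "A \<subseteq> {..<i} \<Longrightarrow> i \<le> x \<Longrightarrow> (card A choose 2) + card A < 2 * 2 ^ x"
proof -
  assume A: "A \<subseteq> {..<i}" "i \<le> x"
  then have "card A \<le> x"
    using card_mono[of "{..<i}" A] by simp
  then have "(2::nat) ^ card A \<le> 2 ^ x"
    by (intro power_increasing) auto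
  moreover have "card A < 2 ^ card A" "card A choose 2 \<le> 2 ^ card A"
    by (rule less_exp, rule binomial_le_pow2)
  ultimately show ?thesis by linarith
qed

lemma split_nth:
  assumes "j < 3 ^ i" "splits i ! j = (A, B)"
  shows "A \<inter> B = {}" "A \<subseteq> {..<i}" "B \<subseteq> {..<i}" "enc A < 2 ^ i" "enc B < 2 ^ i" "enc A + enc B < 2 ^ i"
proof -
  have "(A, B) \<in> set (splits i)"
    using assms by (metis length_splits nth_mem)
  then show AB: "A \<inter> B = {}" "A \<subseteq> {..<i}" "B \<subseteq> {..<i}"
    by (auto simp: in_splits)
  then show "enc A < 2 ^ i" "enc B < 2 ^ i"
    by (auto intro: enc_less)
  have "enc A + enc B = enc (A \<union> B)"
    using AB by (intro enc_union[of _ _ i]) auto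
  then show "enc A + enc B < 2 ^ i"
    using AB enc_less[of "A \<union> B" i] by simp
qed

text \<open>All passes share an allowance of 80 steps per entry, 82 with the loop overhead; a field
  access takes 8.\<close>

lemma wp_sweep:
  assumes "std r" "r rLen = 3 ^ x" "X \<subseteq> scratch"
    and "I 0 m"
    and "\<And>j t' r' m'. \<lbrakk>j < 3 ^ x; I j m'; \<forall>x. x \<noteq> rI \<longrightarrow> x \<notin> X \<longrightarrow> r' x = r x; r' rI = j\<rbrakk> \<Longrightarrow>
      wp W p (\<lambda>t'' r'' m''. t'' \<le> t' + 80 \<and> I (Suc j) m'' \<and> (\<forall>x. x \<notin> X \<longrightarrow> r'' x = r' x)) t' r' m'"
    and "\<And>t' r' m'. \<lbrakk>t' \<le> t + 2 + 82 * 3 ^ x; I (3 ^ x) m'; \<forall>x. x \<noteq> rI \<longrightarrow> x \<notin> X \<longrightarrow> r' x = r x\<rbrakk>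
      \<Longrightarrow> Q t' r' m'"
  shows "wp W (for_loop rOne rI rLen p) Q t r m"
proof (rule wp_for_loop[where I = I and K = "\<lambda>_. 80" and X = X and N = "3 ^ x"])
  show "3 ^ x < W" using W pow3_x(3) by simp
  fix t' r' m'
  assume "t' \<le> t + 2 + (\<Sum>j<(3::nat) ^ x. 80 + 2)" and "I (3 ^ x) m'"
    and "\<forall>x. x \<noteq> rI \<longrightarrow> x \<notin> X \<longrightarrow> r' x = r x"
  then show "Q t' r' m'" by (intro assms(6)) auto
qed (use assms in \<open>auto simp: std_def\<close>)

lemma entry_nth:
  assumes "entries F (splits x)" "j < 3 ^ x" "splits x ! j = (A, B)"
  shows "F 5 j = enc A" "F 6 j = enc B" "F 7 j = card A" "F 8 j = card A choose 2"
  using assms by (auto simp: entries_def length_splits)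

lemma wp_count:
  assumes r: "std r" "r rLen = 3 ^ x" "r rMask = N" "r rB = 2 ^ i" "i < x"
    and F: "entries F (splits x)" "\<And>a. F 4 a \<le> bound" "bound + 3 ^ x < W"
    and Q: "\<And>t' r'. \<lbrakk>t' \<le> t + 2 + 82 * 3 ^ x; \<forall>x. x \<noteq> rI \<longrightarrow> x \<notin> scratch \<longrightarrow> r' x = r x\<rbrakk>
      \<Longrightarrow> Q t' r' (lay (F(4 := fold (count_step i N) (splits x) (F 4))))"
  shows "wp W (for_loop rOne rI rLen count_body) Q t r (lay F)"
proof (rule wp_sweep[where X = scratch and
    I = "\<lambda>j m. m = lay (F(4 := fold (count_step i N) (take j (splits x)) (F 4)))"])
  fix j t' r' m'
  let ?h = "fold (count_step i N) (take j (splits x)) (F 4)"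
  assume j: "j < 3 ^ x" and m': "m' = lay (F(4 := ?h))"
    and r': "\<forall>x. x \<noteq> rI \<longrightarrow> x \<notin> scratch \<longrightarrow> r' x = r x" "r' rI = j"
  obtain A B where e: "splits x ! j = (A, B)" by force
  note AB = split_nth[OF j e] entry_nth[OF F(1) j e]
  have h: "?h a + 1 < W" for a
  proof -
    have "?h a \<le> F 4 a + length (take j (splits x))"
      by (rule fold_count_le)
    also have "\<dots> \<le> F 4 a + j" by simp
    finally show ?thesis using F(2)[of a] F(3) j by linarith
  qed
  have "(2::nat) ^ i \<le> 2 ^ x" using r(5) by (intro power_increasing) auto
  then have "enc A + 2 ^ i \<le> M" using AB(4) pow2_x(1) by linarith
  then show "wp W count_body (\<lambda>t'' r'' m''. t'' \<le> t' + 80 \<and>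
      m'' = lay (F(4 := fold (count_step i N) (take (Suc j) (splits x)) (F 4))) \<and>
      (\<forall>x. x \<notin> scratch \<longrightarrow> r'' x = r' x)) t' r' m'"
    using r r' AB W pow2_x(1) pow3_x(3) j h
    by (simp add: count_body_def entry_sum_def wp_rw std_def m' fold_take_Suc length_splits e count_step_def)
qed (use r Q in \<open>auto simp: length_splits\<close>)

lemma wp_weight:
  assumes r: "std r" "r rLen = 3 ^ x" "r rMask = N"
    and F: "entries F (splits x)"
    and Q: "\<And>t' r'. \<lbrakk>t' \<le> t + 2 + 82 * 3 ^ x; \<forall>x. x \<noteq> rI \<longrightarrow> x \<notin> scratch \<longrightarrow> r' x = r x\<rbrakk>
      \<Longrightarrow> Q t' r' (lay (F(3 := fold (weight_step (F 4) (0 < r rB) N) (splits x) (F 3))))"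
  shows "wp W (for_loop rOne rI rLen weight_body) Q t r (lay F)"
proof (rule wp_sweep[where X = scratch and
    I = "\<lambda>j m. m = lay (F(3 := fold (weight_step (F 4) (0 < r rB) N) (take j (splits x)) (F 3)))"])
  fix j t' r' m'
  let ?h = "fold (weight_step (F 4) (0 < r rB) N) (take j (splits x)) (F 3)"
  assume j: "j < 3 ^ x" and m': "m' = lay (F(3 := ?h))"
    and r': "\<forall>x. x \<noteq> rI \<longrightarrow> x \<notin> scratch \<longrightarrow> r' x = r x" "r' rI = j"
  obtain A B where e: "splits x ! j = (A, B)" by force
  note AB = split_nth[OF j e] entry_nth[OF F(1) j e] choose_bound[OF split_nth(2)[OF j e]]
  show "wp W weight_body (\<lambda>t'' r'' m''. t'' \<le> t' + 80 \<and>
      m'' = lay (F(3 := fold (weight_step (F 4) (0 < r rB) N) (take (Suc j) (splits x)) (F 3))) \<and>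
      (\<forall>x. x \<notin> scratch \<longrightarrow> r'' x = r' x)) t' r' m'"
    using r r' AB W pow2_x(1) pow3_x(3) j
    by (simp add: weight_body_def entry_sum_def wp_rw std_def m' fold_take_Suc length_splits e weight_step_def)
qed (use r Q in \<open>auto simp: length_splits\<close>)

lemma wp_max:
  assumes r: "std r" "r rLen = 3 ^ x"
    and F: "entries F (splits x)" "\<And>A B. (A, B) \<in> set (splits x) \<Longrightarrow> F 3 (enc A) + F 9 (enc B) < W"
    and Q: "\<And>t' r'. \<lbrakk>t' \<le> t + 2 + 82 * 3 ^ x; \<forall>x. x \<noteq> rI \<longrightarrow> x \<notin> scratch \<longrightarrow> r' x = r x\<rbrakk>
      \<Longrightarrow> Q t' r' (lay (F(2 := fold (max_step (F 9) (F 3)) (splits x) (F 2))))"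
  shows "wp W (for_loop rOne rI rLen max_body) Q t r (lay F)"
proof (rule wp_sweep[where X = scratch and
    I = "\<lambda>j m. m = lay (F(2 := fold (max_step (F 9) (F 3)) (take j (splits x)) (F 2)))"])
  fix j t' r' m'
  let ?h = "fold (max_step (F 9) (F 3)) (take j (splits x)) (F 2)"
  assume j: "j < 3 ^ x" and m': "m' = lay (F(2 := ?h))"
    and r': "\<forall>x. x \<noteq> rI \<longrightarrow> x \<notin> scratch \<longrightarrow> r' x = r x" "r' rI = j"
  obtain A B where e: "splits x ! j = (A, B)" by force
  note AB = split_nth[OF j e] entry_nth[OF F(1) j e]
  have "(A, B) \<in> set (splits x)"
    using j e by (metis length_splits nth_mem)
  then have bound: "F 9 (enc B) + F 3 (enc A) < W"
    using F(2) by (simp add: add.commute)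
  have step: "max_step (F 9) (F 3) (A, B) ?h = (if ?h (enc A + enc B) < F 9 (enc B) + F 3 (enc A)
      then ?h(enc A + enc B := F 9 (enc B) + F 3 (enc A)) else ?h)"
    by (auto simp: max_step_def max_def)
  show "wp W max_body (\<lambda>t'' r'' m''. t'' \<le> t' + 80 \<and>
      m'' = lay (F(2 := fold (max_step (F 9) (F 3)) (take (Suc j) (splits x)) (F 2))) \<and>
      (\<forall>x. x \<notin> scratch \<longrightarrow> r'' x = r' x)) t' r' m'"
    using r r' AB bound W pow2_x(1) pow3_x(3) j
    by (simp add: max_body_def entry_sum_def wp_rw std_def m' fold_take_Suc length_splits e step)
qed (use r Q in \<open>auto simp: length_splits\<close>)

lemma wp_copy:
  assumes r: "std r" "r rLen = 3 ^ x"
    and F: "entries F (splits x)"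
    and Q: "\<And>t' r'. \<lbrakk>t' \<le> t + 2 + 82 * 3 ^ x; \<forall>x. x \<noteq> rI \<longrightarrow> x \<notin> scratch \<longrightarrow> r' x = r x\<rbrakk>
      \<Longrightarrow> Q t' r' (lay (F(9 := fold (copy_step (F 2)) (splits x) (F 9),
        3 := fold (copy_step (\<lambda>_. 0)) (splits x) (F 3))))"
  shows "wp W (for_loop rOne rI rLen copy_body) Q t r (lay F)"
proof (rule wp_sweep[where X = scratch and
    I = "\<lambda>j m. m = lay (F(9 := fold (copy_step (F 2)) (take j (splits x)) (F 9),
        3 := fold (copy_step (\<lambda>_. 0)) (take j (splits x)) (F 3)))"])
  fix j t' r' m'
  let ?F = "\<lambda>j. F(9 := fold (copy_step (F 2)) (take j (splits x)) (F 9),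
        3 := fold (copy_step (\<lambda>_. 0)) (take j (splits x)) (F 3))"
  assume j: "j < 3 ^ x" and m': "m' = lay (?F j)"
    and r': "\<forall>x. x \<noteq> rI \<longrightarrow> x \<notin> scratch \<longrightarrow> r' x = r x" "r' rI = j"
  obtain A B where e: "splits x ! j = (A, B)" by force
  note AB = split_nth[OF j e] entry_nth[OF F(1) j e]
  show "wp W copy_body (\<lambda>t'' r'' m''. t'' \<le> t' + 80 \<and> m'' = lay (?F (Suc j)) \<and>
      (\<forall>x. x \<notin> scratch \<longrightarrow> r'' x = r' x)) t' r' m'"
    using r r' AB W pow2_x(1) pow3_x(3) j
    by (simp add: copy_body_def wp_rw std_def m' fold_take_Suc length_splits e copy_step_def
        fun_upd_twist)
qed (use r Q in \<open>auto simp: length_splits\<close>)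

end

section \<open>Building the table of pairs in place\<close>

context cover_input
begin

abbreviation (input) "partial_splits i j \<equiv> splits i @ concat (map (extend i) (take j (splits i)))"

lemma length_partial: "j \<le> 3 ^ i \<Longrightarrow> length (partial_splits i j) = 3 ^ i + 2 * j"
  by (simp add: length_extend length_splits)

text \<open>Round \<open>j\<close> reads entry \<open>j\<close> of the old table and writes behind
  its end, so old entries survive until they are read.\<close>

lemma wp_extend:
  assumes r: "std r" "r rLen0 = 3 ^ i" "r rBB = 2 ^ i" "i < x"
    and F: "entries F (splits i)"
    and Q: "\<And>t' r' F'. \<lbrakk>t' \<le> t + 2 + 122 * 3 ^ i; entries F' (splits (Suc i));
        \<forall>f. f \<notin> {5, 6, 7, 8} \<longrightarrow> F' f = F f;
        \<forall>x. x \<noteq> rI \<longrightarrow> x \<notin> insert rLen scratch \<longrightarrow> r' x = r x\<rbrakk> \<Longrightarrow> Q t' r' (lay F')"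
  shows "wp W (for_loop rOne rI rLen0 extend_body) Q t r (lay F)"
proof (rule wp_for_loop[where X = "insert rLen scratch" and N = "3 ^ i" and K = "\<lambda>_. 120" and
    I = "\<lambda>j m. \<exists>F'. m = lay F' \<and> entries F' (partial_splits i j) \<and>
      (\<forall>f. f \<notin> {5, 6, 7, 8} \<longrightarrow> F' f = F f)"])
  have le: "(3::nat) ^ Suc i \<le> 3 ^ x"
    using r(4) by (intro power_increasing) auto
  with pow3_x(3) W show "3 ^ i < W" by simp
  fix j t' r' m'
  assume j: "j < 3 ^ i" and "\<exists>F'. m' = lay F' \<and> entries F' (partial_splits i j) \<and>
      (\<forall>f. f \<notin> {5, 6, 7, 8} \<longrightarrow> F' f = F f)"
    and r': "\<forall>x. x \<noteq> rI \<longrightarrow> x \<notin> insert rLen scratch \<longrightarrow> r' x = r x" "r' rI = j"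
  then obtain F' where m': "m' = lay F'" and ents: "entries F' (partial_splits i j)"
    and other: "\<forall>f. f \<notin> {5, 6, 7, 8} \<longrightarrow> F' f = F f" by blast
  obtain A B where e: "splits i ! j = (A, B)" by force
  note AB = split_nth[OF j e] choose_bound[OF split_nth(2)[OF j e]]
  have fin: "finite A" "finite B" "i \<notin> A" "i \<notin> B"
    using AB(2,3) finite_subset by auto
  have cur: "F' 5 j = enc A" "F' 6 j = enc B" "F' 7 j = card A" "F' 8 j = card A choose 2"
    using ents j e by (auto simp: entries_def length_splits nth_append dest!: spec[of _ j])
  \<comment> \<open>The first free entry after \<open>j\<close> rounds, each of which has appended
    two.\<close>
  define p where "p = 3 ^ i + 2 * j"
  have p: "p + 1 < M" "j < M"
    using j le pow3_x(3) by (simp_all add: p_def)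
  have pow: "(2::nat) ^ i + 2 ^ i \<le> M"
  proof -
    have "(2::nat) ^ Suc i \<le> 2 ^ x" using r(4) by (intro power_increasing) auto
    then show ?thesis using pow2_x(1) by simp
  qed
  have bound: "enc A + 2 ^ i < W" "enc B + 2 ^ i < W" "(card A choose 2) + card A + 1 < W"
    using AB pow pow2_x(1) W r(4) by linarith+
  have ents_Suc: "entries F'' (partial_splits i (Suc j))"
    if F'': "\<And>f q. q < p \<Longrightarrow> F'' f q = F' f q"
      "F'' 5 p = enc A + 2 ^ i" "F'' 6 p = enc B" "F'' 7 p = card A + 1" "F'' 8 p = (card A choose 2) + card A"
      "F'' 5 (Suc p) = enc A" "F'' 6 (Suc p) = enc B + 2 ^ i" "F'' 7 (Suc p) = card A" "F'' 8 (Suc p) = card A choose 2"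
    for F''
  proof -
    have split: "partial_splits i (Suc j) = partial_splits i j @ [(insert i A, B), (A, insert i B)]"
      using j by (simp add: take_Suc_conv_app_nth length_splits e extend_def)
    have len: "length (partial_splits i j) = p"
      using j by (subst length_partial) (simp_all add: p_def)
    show ?thesis
      unfolding entries_def split
    proof (intro allI impI)
      fix q assume "q < length (partial_splits i j @ [(insert i A, B), (A, insert i B)])"
      then consider "q < p" | "q = p" | "q = Suc p" using len by fastforce
      then show "F'' 5 q = enc (fst ((partial_splits i j @ [(insert i A, B), (A, insert i B)]) ! q)) \<and>
        F'' 6 q = enc (snd ((partial_splits i j @ [(insert i A, B), (A, insert i B)]) ! q)) \<and>
        F'' 7 q = card (fst ((partial_splits i j @ [(insert i A, B), (A, insert i B)]) ! q)) \<and>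
        F'' 8 q = card (fst ((partial_splits i j @ [(insert i A, B), (A, insert i B)]) ! q)) choose 2"
      proof cases
        case 1
        with ents len F''(1) show ?thesis by (simp only: nth_append entries_def if_True)
      next
        case 2
        with len F'' fin show ?thesis by (simp only: nth_append) (simp add: numeral_2_eq_2)
      next
        case 3
        with len F'' fin show ?thesis by (simp only: nth_append) simp
      qed
    qed
  qed
  have "wp W extend_body (\<lambda>t'' r'' m''. t'' \<le> t' + 120 \<and> (\<exists>F''. m'' = lay F'' \<and>
      (\<forall>f q. q < p \<longrightarrow> F'' f q = F' f q) \<and> (\<forall>f. f \<notin> {5, 6, 7, 8} \<longrightarrow> F'' f = F' f) \<and>
      F'' 5 p = enc A + 2 ^ i \<and> F'' 6 p = enc B \<and> F'' 7 p = card A + 1 \<and> F'' 8 p = (card A choose 2) + card A \<and>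
      F'' 5 (Suc p) = enc A \<and> F'' 6 (Suc p) = enc B + 2 ^ i \<and> F'' 7 (Suc p) = card A \<and> F'' 8 (Suc p) = card A choose 2) \<and>
      (\<forall>x. x \<notin> insert rLen scratch \<longrightarrow> r'' x = r' x)) t' r' m'"
  proof -
    have p': "3 ^ i + j + j = p" "3 ^ i + j < W" "p < W" "base + 16 * p + 16 < W" "base + 16 * Suc p + 8 < W" "base + 16 * j + 8 < W"
      using p W j by (simp_all add: p_def)
    show ?thesis
      unfolding m' using r r' bound cur p'
      by (simp add: extend_body_def wp_rw std_def) (intro exI conjI, rule refl, auto)
  qed
  then show "wp W extend_body (\<lambda>t'' r'' m''. t'' \<le> t' + 120 \<and> (\<exists>F''. m'' = lay F'' \<and>
      entries F'' (partial_splits i (Suc j)) \<and> (\<forall>f. f \<notin> {5, 6, 7, 8} \<longrightarrow> F'' f = F f)) \<and>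
      (\<forall>x. x \<notin> insert rLen scratch \<longrightarrow> r'' x = r' x)) t' r' m'"
  proof (rule wp_mono, goal_cases)
    case (1 t'' r'' m'')
    then obtain F'' where F'': "m'' = lay F''" "entries F'' (partial_splits i (Suc j))" "\<forall>f. f \<notin> {5, 6, 7, 8} \<longrightarrow> F'' f = F' f"
      using ents_Suc by (elim conjE exE) (metis (no_types, lifting))
    moreover from this(3) other have "\<forall>f. f \<notin> {5, 6, 7, 8} \<longrightarrow> F'' f = F f" by simp
    ultimately show ?case using 1 by blast
  qed
next
  fix t' r' m'
  assume t': "t' \<le> t + 2 + (\<Sum>j<(3::nat) ^ i. 120 + 2)"
    and "\<exists>F'. m' = lay F' \<and> entries F' (partial_splits i (3 ^ i)) \<and>
      (\<forall>f. f \<notin> {5, 6, 7, 8} \<longrightarrow> F' f = F f)"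
    and r': "\<forall>x. x \<noteq> rI \<longrightarrow> x \<notin> insert rLen scratch \<longrightarrow> r' x = r x"
  then obtain F' where F': "m' = lay F'" "entries F' (partial_splits i (3 ^ i))"
    "\<forall>f. f \<notin> {5, 6, 7, 8} \<longrightarrow> F' f = F f" by blast
  have "partial_splits i (3 ^ i) = splits (Suc i)"
    using length_splits[of i] by simp
  with F' r' t' show "Q t' r' m'" by (auto intro!: Q)
qed (use r F in \<open>auto simp: std_def\<close>)

lemma wp_build_splits:
  assumes r: "std r" "r rP = 2 ^ x"
    and F: "entries F (splits 0)"
    and Q: "\<And>t' r' F'. \<lbrakk>t' \<le> t + 3 + 200 * 3 ^ x; entries F' (splits x); r' rLen = 3 ^ x;
        \<forall>f. f \<notin> {5, 6, 7, 8} \<longrightarrow> F' f = F f;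
        \<forall>x. x \<notin> {rI, rLen, rLen0, rBB} \<union> scratch \<longrightarrow> r' x = r x\<rbrakk> \<Longrightarrow> Q t' r' (lay F')"
  shows "wp W build_splits Q t r (lay F)"
proof -
  let ?body = "Copy rLen0 rLen ;; for_loop rOne rI rLen0 extend_body ;;
       Add rLen rLen0 rLen0 ;; Add rLen rLen rLen0 ;; Add rBB rBB rBB"
  let ?I = "\<lambda>i t' r' m'. i \<le> x \<and> t' \<le> t + 2 + 200 * 3 ^ i \<and> r' rBB = 2 ^ i \<and> r' rLen = 3 ^ i \<and>
    (\<exists>F'. m' = lay F' \<and> entries F' (splits i) \<and> (\<forall>f. f \<notin> {5, 6, 7, 8} \<longrightarrow> F' f = F f)) \<and>
    (\<forall>x. x \<notin> {rI, rLen, rLen0, rBB} \<union> scratch \<longrightarrow> r' x = r x)"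
  have "wp W (WhileLess rBB rP ?body) Q (t + 2) (r(rBB := 1, rLen := 1)) (lay F)"
  proof (rule wp_while[of ?I _ _ _ _ _ x])
    show "?I 0 (t + 2) (r(rBB := 1, rLen := 1)) (lay F)"
      using F by auto
  next
    fix i t' r' m'
    assume I: "?I i t' r' m'" and "r' rBB < r' rP"
    then have "(2::nat) ^ i < 2 ^ x" using r(2) by auto
    then have i: "i < x" by simp
    from I obtain F' where F': "m' = lay F'" "entries F' (splits i)" "\<forall>f. f \<notin> {5, 6, 7, 8} \<longrightarrow> F' f = F f"
      by blast
    have three: "(3::nat) ^ Suc i \<le> 3 ^ x" and two: "(2::nat) ^ Suc i \<le> 2 ^ x"
      using i by (intro power_increasing; simp)+
    have "wp W ?body (?I (Suc i)) (t' + 1) r' (lay F')"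
      unfolding wp_Seq wp_Copy
    proof (rule wp_extend[OF _ _ _ i F'(2)], goal_cases)
      case (4 t'' r'' F'')
      have "1 \<le> (3::nat) ^ i" by simp
      moreover have "t'' \<le> t' + 2 + 2 + 122 * 3 ^ i" "t' \<le> t + 2 + 200 * 3 ^ i"
        using 4(1) I by auto
      \<comment> \<open>Geometric growth: the new cost \<open>122 * 3 ^ i\<close> and the constants
        fit between \<open>200 * 3 ^ i\<close> and \<open>200 * 3 ^ Suc i\<close>.\<close>
      ultimately have "t'' + 3 \<le> t + 2 + 600 * 3 ^ i" by linarith
      with 4 I F' r three two W pow3_x(3) pow2_x(1) i show ?case
        by (auto intro!: exI[of _ F''])
    qed (use r I in \<open>auto simp: std_def\<close>)
    with i F'(1) show "i < x \<and> wp W ?body (?I (Suc i)) (t' + 1) r' m'" by simp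
  next
    fix i t' r' m'
    assume I: "?I i t' r' m'" and "\<not> r' rBB < r' rP"
    then have "\<not> (2::nat) ^ i < 2 ^ x" using r(2) by auto
    then have "i = x" using I by simp
    with I obtain F' where "m' = lay F'" "entries F' (splits x)" "\<forall>f. f \<notin> {5, 6, 7, 8} \<longrightarrow> F' f = F f"
      by blast
    moreover have "t' + 1 \<le> t + 3 + 200 * 3 ^ x" "r' rLen = 3 ^ x"
      using I \<open>i = x\<close> by auto
    ultimately show "Q (t' + 1) r' m'" using Q I by blast
  qed
  then show ?thesis
    using W by (simp add: build_splits_def add.commute)
qed

end

section \<open>The dynamic program on the machine\<close>

text \<open>For distinct \<open>xs\<close> at most one summand is nonzero. Written as a sum, it
  allows the exchange of summations in \<open>sum_bitval\<close>.\<close>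

definition bitval :: "nat list \<Rightarrow> nat \<Rightarrow> nat" where
  "bitval xs u = (\<Sum>i<length xs. if xs ! i = u then 2 ^ i else 0)"

lemma bitval_notin: "u \<notin> set xs \<Longrightarrow> bitval xs u = 0"
  by (auto simp: bitval_def in_set_conv_nth)

lemma bitval_nth:
  assumes "distinct xs" "i < length xs"
  shows "bitval xs (xs ! i) = 2 ^ i"
proof -
  have "bitval xs (xs ! i) = (\<Sum>j<length xs. if j = i then 2 ^ j else 0)"
    unfolding bitval_def using assms by (intro sum.cong) (auto simp: nth_eq_iff_index_eq)
  with assms show ?thesis by simp
qed

lemma bitval_pos_iff: "distinct xs \<Longrightarrow> 0 < bitval xs u \<longleftrightarrow> u \<in> set xs"
  by (metis bitval_notin bitval_nth in_set_conv_nth less_numeral_extra(3) zero_less_numeral zero_less_power)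

lemma bitval_snoc:
  assumes "v \<notin> set xs"
  shows "bitval (xs @ [v]) = (bitval xs)(v := 2 ^ length xs)"
proof
  fix u
  have "bitval (xs @ [v]) u = bitval xs u + (if v = u then 2 ^ length xs else 0)"
    by (simp add: bitval_def nth_append)
  with assms show "bitval (xs @ [v]) u = ((bitval xs)(v := 2 ^ length xs)) u"
    by (simp add: bitval_notin)
qed

text \<open>\<open>S\<close> is a clique iff all of its elements are counted here; the program does so vertex by vertex.\<close>

definition members :: "nat set set \<Rightarrow> nat list \<Rightarrow> nat set \<Rightarrow> nat \<Rightarrow> nat set" where
  "members E xs S v = {i \<in> S. xs ! i < v \<and> S - {i} \<subseteq> nbrs E xs (xs ! i)}"

text \<open>The counted elements form a subset of the finite set \<open>S\<close>, so equal
  cardinality forces equality.\<close>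

lemma clq_iff_card:
  assumes "finite S" "\<And>i. i \<in> S \<Longrightarrow> xs ! i < v"
  shows "card (members E xs S v) = card S \<longleftrightarrow> clq E xs S"
proof
  assume "card (members E xs S v) = card S"
  with assms(1) have "members E xs S v = S"
    by (intro card_subset_eq) (auto simp: members_def)
  then show "clq E xs S" by (auto simp: members_def clq_def)
next
  assume "clq E xs S"
  with assms(2) have "members E xs S v = S" by (auto simp: members_def clq_def)
  then show "card (members E xs S v) = card S" by simp
qed

lemma card_members_Suc:
  assumes xs: "distinct xs" "i < length xs" and S: "S \<subseteq> {..<length xs}"
  shows "card (members E xs S (Suc (xs ! i))) = card (members E xs S (xs ! i)) +
    (if i \<in> S \<and> S - {i} \<subseteq> nbrs E xs (xs ! i) then 1 else 0)"
proof -
  have fin: "finite (members E xs S (xs ! i))"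
    using S finite_subset by (fastforce simp: members_def)
  have "xs ! j < Suc (xs ! i) \<longleftrightarrow> xs ! j < xs ! i \<or> j = i" if "j \<in> S" for j
    using xs S that by (auto simp: less_Suc_eq nth_eq_iff_index_eq)
  then have "members E xs S (Suc (xs ! i)) =
    (if i \<in> S \<and> S - {i} \<subseteq> nbrs E xs (xs ! i) then insert i (members E xs S (xs ! i)) else members E xs S (xs ! i))"
    unfolding members_def by auto
  moreover have "i \<notin> members E xs S (xs ! i)" by (simp add: members_def)
  ultimately show ?thesis using fin by simp
qed

lemma members_Suc_notin:
  assumes "v \<notin> set xs" "S \<subseteq> {..<length xs}"
  shows "members E xs S (Suc v) = members E xs S v"
proof -
  have "xs ! j \<noteq> v" if "j \<in> S" for j
    using assms that nth_mem by fastforce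
  then show ?thesis by (auto simp: members_def less_Suc_eq)
qed

definition count_phase :: com where
  "count_phase = for_loop rOne rV rN
     (get 0 rB rV ;; IfLess rZero rB (scan ;; for_loop rOne rI rLen count_body) Skip)"

text \<open>For a cover vertex the mask \<open>2 ^ x - 1\<close> admits all subsets and no list is
  read; any other vertex uses its neighbourhood. \<open>rB\<close> carries the distinction on to
  \<open>weight_body\<close>.\<close>

definition round_phase :: com where
  "round_phase = for_loop rOne rV rN
     (get 0 rB rV ;; IfLess rZero rB (Sub rMask rP rOne) scan ;;
      for_loop rOne rI rLen weight_body ;; for_loop rOne rI rLen max_body ;; for_loop rOne rI rLen copy_body)"

definition answer :: com where
  "answer = Sub rT rP rOne ;; get 9 rD rT ;; IfLess rD rL (Const 0 0) (Const 0 1)"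

abbreviation (input) "scratch2 \<equiv> {rB, rMask, rA, rE, rU, rB2, rI} \<union> scratch"

context machine_input
begin

lemma adj_set: "v < n \<Longrightarrow> set (adj ! v) = {u. {v, u} \<in> E}" "v < n \<Longrightarrow> distinct (adj ! v)"
  using adj by (simp_all add: adjacency_lists_def)

lemma degree_le: "v < n \<Longrightarrow> length (adj ! v) \<le> n"
  using adj_less[of v] adj_set(2)[of v] card_mono[of "{..<n}" "set (adj ! v)"]
  by (auto simp: distinct_card)

lemma sum_bitval:
  assumes "v < n"
  shows "sum_list (map (bitval xs) (adj ! v)) = enc (nbrs E xs v)"
proof -
  let ?N = "{u. {v, u} \<in> E}"
  have fin: "finite ?N" using adj_set(1)[OF assms] by (metis List.finite_set)
  have "sum_list (map (bitval xs) (adj ! v)) = (\<Sum>u\<in>?N. bitval xs u)"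
    using adj_set[OF assms] by (simp add: sum_list_distinct_conv_sum_set)
  also have "\<dots> = (\<Sum>i<length xs. \<Sum>u\<in>?N. if xs ! i = u then 2 ^ i else 0)"
    unfolding bitval_def by (rule sum.swap)
  also have "\<dots> = (\<Sum>i<length xs. if xs ! i \<in> ?N then 2 ^ i else 0)"
    using fin by (intro sum.cong) (simp_all add: sum.delta)
  also have "\<dots> = (\<Sum>i\<in>{i \<in> {..<length xs}. xs ! i \<in> ?N}. 2 ^ i)"
    by (rule sum.inter_filter[symmetric]) simp
  also have "\<dots> = enc (nbrs E xs v)"
    by (simp add: set_encode_def nbrs_def)
  finally show ?thesis .
qed

end

section \<open>The clique test and the rounds\<close>

context cover_input
begin

lemma nbrs_subset: "nbrs E xs v \<subseteq> {..<x}"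
  by (auto simp: nbrs_def length_xs)

lemma nbrs_irrefl: "i < x \<Longrightarrow> i \<notin> nbrs E xs (xs ! i)"
  using edgeD(1)[OF graph, of "xs ! i" "xs ! i"] by (auto simp: nbrs_def)

text \<open>Every edge at such a vertex has its other end in the cover. This is what makes scanning
  affordable in the rounds.\<close>

lemma degree_le_cover:
  assumes "v < n" "v \<notin> set xs"
  shows "length (adj ! v) \<le> 2 * l"
proof -
  have "set (adj ! v) \<subseteq> set xs"
    using cover adj_set(1)[OF assms(1)] assms(2) by blast
  then have "card (set (adj ! v)) \<le> card (set xs)"
    by (intro card_mono) simp_all
  then have "length (adj ! v) \<le> length xs"
    using adj_set(2)[OF assms(1)] distinct_xs by (simp add: distinct_card)
  with length_xs x_less show ?thesis by simp
qed

lemma scan_bound: "v < n \<Longrightarrow> F 0 = bitval xs \<Longrightarrow> sum_list (map (F 0) (adj ! v)) < W"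
  using enc_less[OF nbrs_subset, of v] pow2_x(1) W by (simp add: sum_bitval)

text \<open>The first conjunct protects the increments against overflow; the second is the meaning
  of the counters once the vertices below \<open>v\<close> are treated.\<close>

definition counted :: "nat \<Rightarrow> (nat \<Rightarrow> nat) \<Rightarrow> bool" where
  "counted v h \<longleftrightarrow> (\<forall>a. h a \<le> v * 3 ^ x) \<and> (\<forall>S\<subseteq>{..<x}. h (enc S) = card (members E xs S v))"

lemma counted_Suc:
  assumes "counted v h" "i < x" "v = xs ! i"
  shows "counted (Suc v) (fold (count_step i (enc (nbrs E xs v))) (splits x) h)"
  unfolding counted_def
proof (intro conjI allI impI)
  fix a
  show "fold (count_step i (enc (nbrs E xs v))) (splits x) h a \<le> Suc v * 3 ^ x"
  proof -
    have "fold (count_step i (enc (nbrs E xs v))) (splits x) h a \<le> h a + 3 ^ x"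
      using fold_count_le[of i "enc (nbrs E xs v)" "splits x" h a] by (simp only: length_splits)
    moreover have "h a \<le> v * 3 ^ x" using assms(1) by (simp add: counted_def)
    ultimately show ?thesis by simp
  qed
next
  fix S assume S: "S \<subseteq> {..<x}"
  show "fold (count_step i (enc (nbrs E xs v))) (splits x) h (enc S) = card (members E xs S (Suc v))"
    using fold_count[OF assms(2) nbrs_subset _ S, of v h] nbrs_irrefl[OF assms(2)]
      card_members_Suc[OF distinct_xs, of i S E] assms S
    by (simp add: counted_def length_xs)
qed

lemma counted_notin:
  assumes "counted v h" "v \<notin> set xs"
  shows "counted (Suc v) h"
  unfolding counted_def
proof (intro conjI allI impI)
  fix a
  have "h a \<le> v * 3 ^ x" using assms(1) by (simp add: counted_def)
  then show "h a \<le> Suc v * 3 ^ x" by simp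
next
  fix S assume "S \<subseteq> {..<x}"
  then show "h (enc S) = card (members E xs S (Suc v))"
    using assms members_Suc_notin[of v xs S E] by (simp add: counted_def length_xs)
qed

text \<open>Only \<open>x\<close> of the \<open>n\<close> iterations are expensive. A uniform bound
  would charge a full list to every vertex and give \<open>n * n\<close>.\<close>

lemma sum_over_cover: "(\<Sum>v<n. if v \<in> set xs then a else b) \<le> x * a + n * (b :: nat)"
proof -
  have "(\<Sum>v<n. if v \<in> set xs then a else b) \<le> (\<Sum>v<n. (if v \<in> set xs then a else 0) + b)"
    by (intro sum_mono) auto
  also have "\<dots> = (\<Sum>v\<in>{v \<in> {..<n}. v \<in> set xs}. a) + n * b"
    by (simp only: sum.distrib sum.inter_filter[symmetric] finite_lessThan) simp
  also have "{v \<in> {..<n}. v \<in> set xs} = set xs"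
    using xs_less by auto
  also have "card (set xs) = x"
    using distinct_xs length_xs by (simp add: distinct_card)
  then have "(\<Sum>v\<in>set xs. a) = x * a" by simp
  finally show ?thesis by simp
qed

lemma wp_count_phase:
  assumes r: "std r" "r rLen = 3 ^ x"
    and F: "entries F (splits x)" "F 0 = bitval xs" "F 4 = (\<lambda>_. 0)"
    and Q: "\<And>t' r' h. \<lbrakk>t' \<le> t + 2 + x * (40 + 13 * n + 82 * 3 ^ x) + n * 22; counted n h;
        \<forall>x. x \<noteq> rV \<longrightarrow> x \<notin> scratch2 \<longrightarrow> r' x = r x\<rbrakk> \<Longrightarrow> Q t' r' (lay (F(4 := h)))"
  shows "wp W count_phase Q t r (lay F)"
  unfolding count_phase_def
proof (rule wp_for_loop[where X = scratch2 and N = n and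
    K = "\<lambda>v. if v \<in> set xs then 38 + 13 * n + 82 * 3 ^ x else 20" and
    I = "\<lambda>v m. \<exists>h. m = lay (F(4 := h)) \<and> counted v h"])
  show "n < W" using n_less W by simp
  have "counted 0 (\<lambda>_. 0)" by (simp add: counted_def members_def)
  then show "\<exists>h. lay F = lay (F(4 := h)) \<and> counted 0 h"
    using F(3) by (metis fun_upd_triv)
  fix v t' r' m'
  assume v: "v < n" and "\<exists>h. m' = lay (F(4 := h)) \<and> counted v h"
    and r': "\<forall>x. x \<noteq> rV \<longrightarrow> x \<notin> scratch2 \<longrightarrow> r' x = r x" "r' rV = v"
  then obtain h where m': "m' = lay (F(4 := h))" and h: "counted v h" by blast
  let ?F = "F(4 := h)"
  let ?Q = "\<lambda>t'' r'' m''. t'' \<le> t' + (if v \<in> set xs then 38 + 13 * n + 82 * 3 ^ x else 20) \<and>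
      (\<exists>h. m'' = lay (F(4 := h)) \<and> counted (Suc v) h) \<and> (\<forall>x. x \<notin> scratch2 \<longrightarrow> r'' x = r' x)"
  have std: "std r'" "r' rLen = 3 ^ x" using r r' by (auto simp: std_def)
  have addr: "base + 16 * v < W" using v n_less W by simp
  show "wp W (get 0 rB rV ;; IfLess rZero rB (scan ;; for_loop rOne rI rLen count_body) Skip) ?Q t' r' m'"
  proof (cases "v \<in> set xs")
    case False
    then show ?thesis
      using std r'(2) addr h F(2) counted_notin[OF h]
      by (auto simp: m' wp_rw std_def bitval_notin)
  next
    case True
    then obtain i where i: "i < x" "v = xs ! i"
      by (auto simp: in_set_conv_nth length_xs)
    have bv: "bitval xs v = 2 ^ i"
      using i bitval_nth[OF distinct_xs] length_xs by simp
    define r1 where "r1 = r'(rTm := base + 16 * v, rTj := 0, rB := 2 ^ i)"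
    have "wp W (scan ;; for_loop rOne rI rLen count_body) ?Q (t' + 9) r1 (lay ?F)"
      unfolding wp_Seq
    proof (rule wp_scan[of r1 v])
      show "std r1" "r1 rV = v" "v < n"
        using std r'(2) v by (auto simp: std_def r1_def)
      show "sum_list (map (?F 0) (adj ! v)) < W"
        using scan_bound[OF v, of ?F] F(2) by simp
      fix t2 r2
      assume t2: "t2 \<le> t' + 9 + 12 + 13 * length (adj ! v)"
        and mask: "r2 rMask = sum_list (map (?F 0) (adj ! v))"
        and r2: "\<forall>x. x \<notin> {rMask, rA, rE, rU, rB2, rTm, rTj} \<longrightarrow> r2 x = r1 x"
      show "wp W (for_loop rOne rI rLen count_body) ?Q t2 r2 (lay ?F)"
      proof (rule wp_count[of r2 "enc (nbrs E xs v)" i, where bound = "v * 3 ^ x"])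
        show "std r2" "r2 rLen = 3 ^ x" "r2 rB = 2 ^ i" "i < x"
          using std r2 i by (auto simp: std_def r1_def)
        show "r2 rMask = enc (nbrs E xs v)"
          using mask F(2) sum_bitval[OF v] by simp
        show "entries ?F (splits x)"
          using F(1) by (simp add: entries_def)
        show "?F 4 a \<le> v * 3 ^ x" for a
          using h by (simp add: counted_def)
        have "v * 3 ^ x + 3 ^ x \<le> 3 ^ x * (n + 1)"
          using v by (simp add: mult.commute)
        then show "v * 3 ^ x + 3 ^ x < W"
          using pow3_x(2) W by linarith
        fix t3 r3
        assume t3: "t3 \<le> t2 + 2 + 82 * 3 ^ x"
          and r3: "\<forall>x. x \<noteq> rI \<longrightarrow> x \<notin> scratch \<longrightarrow> r3 x = r2 x"
        have "t3 \<le> t' + (38 + 13 * n + 82 * 3 ^ x)"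
          using t2 t3 degree_le[OF v] by linarith
        moreover have "counted (Suc v) (fold (count_step i (enc (nbrs E xs v))) (splits x) h)"
          by (rule counted_Suc[OF h i])
        moreover have "\<forall>x. x \<notin> scratch2 \<longrightarrow> r3 x = r' x"
          using r2 r3 by (simp add: r1_def)
        ultimately show "?Q t3 r3 (lay (?F(4 := fold (count_step i (enc (nbrs E xs v))) (splits x) (?F 4))))"
          using True by auto
      qed
    qed
    moreover have "wp W (get 0 rB rV ;; IfLess rZero rB (scan ;; for_loop rOne rI rLen count_body) Skip) P t' r' m'"
      if "wp W (scan ;; for_loop rOne rI rLen count_body) P (t' + 9) r1 (lay ?F)" for P
      using that std r'(2) addr F(2) bv by (simp add: m' wp_rw std_def r1_def add.commute)
    ultimately show ?thesis by blast
  qed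
next
  fix t' r' m'
  assume t': "t' \<le> t + 2 + (\<Sum>v<n. (if v \<in> set xs then 38 + 13 * n + 82 * 3 ^ x else 20) + 2)"
    and "\<exists>h. m' = lay (F(4 := h)) \<and> counted n h"
    and r': "\<forall>x. x \<noteq> rV \<longrightarrow> x \<notin> scratch2 \<longrightarrow> r' x = r x"
  then obtain h where "m' = lay (F(4 := h))" "counted n h" by blast
  moreover have "(\<Sum>v<n. (if v \<in> set xs then 38 + 13 * n + 82 * 3 ^ x else 20) + 2) =
    (\<Sum>v<n. if v \<in> set xs then 40 + 13 * n + 82 * 3 ^ x else (22::nat))"
    by (intro sum.cong) auto
  then have "t' \<le> t + 2 + x * (40 + 13 * n + 82 * 3 ^ x) + n * 22"
    using t' sum_over_cover[of "40 + 13 * n + 82 * 3 ^ x" 22] by linarith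
  ultimately show "Q t' r' m'" using Q r' by blast
qed (use r in \<open>auto simp: std_def\<close>)

text \<open>The maximum is formed in field 2 while field 9 keeps supplying the previous round, so
  both agree between rounds. Field 3 is 0 because the weight pass leaves inadmissible sets
  untouched.\<close>

definition tabulated :: "nat \<Rightarrow> (nat \<Rightarrow> nat \<Rightarrow> nat) \<Rightarrow> bool" where
  "tabulated v F \<longleftrightarrow> (\<forall>S\<subseteq>{..<x}. F 9 (enc S) = dp E xs v S \<and> F 2 (enc S) = dp E xs v S \<and> F 3 (enc S) = 0)"

text \<open>The additional candidate is the choice \<open>A = {}\<close>, of weight 0.\<close>

lemma dp_Suc_insert:
  assumes "S \<subseteq> {..<x}"
  shows "dp E xs (Suc v) S = Max (insert (dp E xs v S) ((\<lambda>A. dp E xs v (S - A) + weight E xs v A) ` Pow S))"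
proof -
  have "weight E xs v {} = 0" by (simp add: weight_def)
  then have "dp E xs v S = (\<lambda>A. dp E xs v (S - A) + weight E xs v A) {}" by simp
  then have "dp E xs v S \<in> (\<lambda>A. dp E xs v (S - A) + weight E xs v A) ` Pow S" by blast
  then show ?thesis by (simp add: insert_absorb)
qed

abbreviation (input) "round_mask v \<equiv> enc (if v \<in> set xs then {..<x} else nbrs E xs v)"

text \<open>All cover vertices lie below \<open>n\<close>, so after the counting phase a full
  counter means that every row has passed.\<close>

lemma fold_weight_eq:
  assumes "counted n cnt" "S \<subseteq> {..<x}" "h (enc S) = 0"
  shows "fold (weight_step cnt (v \<in> set xs) (round_mask v)) (splits x) h (enc S) = weight E xs v S"
proof -
  have "finite S" using assms(2) finite_subset by blast
  moreover have "xs ! i < n" if "i \<in> S" for i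
  proof -
    have "xs ! i \<in> set xs" using assms(2) that length_xs by (intro nth_mem) auto
    then show ?thesis using xs_less by auto
  qed
  ultimately have "cnt (enc S) = card S \<longleftrightarrow> clq E xs S"
    using clq_iff_card[of S xs n E] assms(1,2) by (simp add: counted_def)
  moreover have "(if v \<in> set xs then {..<x} else nbrs E xs v) \<subseteq> {..<x}"
    using nbrs_subset by simp
  ultimately show ?thesis
    using assms(2,3) by (auto simp: fold_weight[OF _ assms(2)] weight_def)
qed

text \<open>In the bound, 246 stands for three passes at 82 steps per entry, and
  \<open>26 * l\<close> for a scan of at most \<open>2 * l\<close> neighbours at 13 steps
  each.\<close>

lemma wp_round_phase:
  assumes r: "std r" "r rLen = 3 ^ x" "r rP = 2 ^ x"
    and F: "entries F (splits x)" "F 0 = bitval xs" "counted n (F 4)" "tabulated 0 F"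
    and Q: "\<And>t' r' F'. \<lbrakk>t' \<le> t + 2 + n * (40 + 26 * l + 246 * 3 ^ x); tabulated n F';
        \<forall>x. x \<noteq> rV \<longrightarrow> x \<notin> scratch2 \<longrightarrow> r' x = r x\<rbrakk> \<Longrightarrow> Q t' r' (lay F')"
  shows "wp W round_phase Q t r (lay F)"
  unfolding round_phase_def
proof (rule wp_for_loop[where X = scratch2 and N = n and
    K = "\<lambda>_. 38 + 26 * l + 246 * 3 ^ x" and
    I = "\<lambda>v m. \<exists>F'. m = lay F' \<and> tabulated v F' \<and> (\<forall>f. f \<notin> {2, 3, 9} \<longrightarrow> F' f = F f)"])
  show "n < W" using n_less W by simp
  show "\<exists>F'. lay F = lay F' \<and> tabulated 0 F' \<and> (\<forall>f. f \<notin> {2, 3, 9} \<longrightarrow> F' f = F f)"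
    using F(4) by blast
  fix v t' r' m'
  assume v: "v < n" and "\<exists>F'. m' = lay F' \<and> tabulated v F' \<and> (\<forall>f. f \<notin> {2, 3, 9} \<longrightarrow> F' f = F f)"
    and r': "\<forall>x. x \<noteq> rV \<longrightarrow> x \<notin> scratch2 \<longrightarrow> r' x = r x" "r' rV = v"
  then obtain F0 where m': "m' = lay F0" and tab: "tabulated v F0"
    and other: "\<forall>f. f \<notin> {2, 3, 9} \<longrightarrow> F0 f = F f" by blast
  let ?Q = "\<lambda>t'' r'' m''. t'' \<le> t' + (38 + 26 * l + 246 * 3 ^ x) \<and>
      (\<exists>F'. m'' = lay F' \<and> tabulated (Suc v) F' \<and> (\<forall>f. f \<notin> {2, 3, 9} \<longrightarrow> F' f = F f)) \<and>
      (\<forall>x. x \<notin> scratch2 \<longrightarrow> r'' x = r' x)"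
  let ?sweeps = "for_loop rOne rI rLen weight_body ;; for_loop rOne rI rLen max_body ;; for_loop rOne rI rLen copy_body"
  have std: "std r'" "r' rLen = 3 ^ x" "r' rP = 2 ^ x" using r r' by (auto simp: std_def)
  have addr: "base + 16 * v < W" using v n_less W by simp
  have F0: "entries F0 (splits x)" "F0 0 = bitval xs" "counted n (F0 4)"
    using F(1-3) other by (simp_all add: entries_def)
  have sweeps: "wp W ?sweeps ?Q t1 r1 (lay F0)"
    if t1: "t1 \<le> t' + 22 + 26 * l" and mask: "r1 rMask = round_mask v"
      and r1: "r1 rB = bitval xs v" "\<forall>x. x \<notin> scratch2 \<longrightarrow> r1 x = r' x" for t1 r1
  proof -
    \<comment> \<open>The fields after the weight pass, the maximum pass and the copy pass.\<close>
    define F1 where "F1 = F0(3 := fold (weight_step (F0 4) (v \<in> set xs) (round_mask v)) (splits x) (F0 3))"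
    define F2 where "F2 = F1(2 := fold (max_step (F1 9) (F1 3)) (splits x) (F1 2))"
    define F3 where "F3 = F2(9 := fold (copy_step (F2 2)) (splits x) (F2 9),
        3 := fold (copy_step (\<lambda>_. 0)) (splits x) (F2 3))"
    have weight: "F1 3 (enc S) = weight E xs v S" if "S \<subseteq> {..<x}" for S
      using tab fold_weight_eq[OF F0(3) that] that by (simp add: F1_def tabulated_def)
    have old: "F1 9 (enc S) = dp E xs v S" "F1 2 (enc S) = dp E xs v S" if "S \<subseteq> {..<x}" for S
      using tab that by (simp_all add: F1_def tabulated_def)
    have new: "F2 2 (enc S) = dp E xs (Suc v) S" if S: "S \<subseteq> {..<x}" for S
    proof -
      have "(\<lambda>A. F1 9 (enc (S - A)) + F1 3 (enc A)) ` Pow S = (\<lambda>A. dp E xs v (S - A) + weight E xs v A) ` Pow S"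
      proof (rule image_cong[OF refl])
        fix A assume "A \<in> Pow S"
        with S have "A \<subseteq> {..<x}" "S - A \<subseteq> {..<x}" by auto
        then show "F1 9 (enc (S - A)) + F1 3 (enc A) = dp E xs v (S - A) + weight E xs v A"
          by (simp only: old weight)
      qed
      then show ?thesis
        unfolding dp_Suc_insert[OF S] F2_def by (simp only: fun_upd_same fold_max[OF S] old[OF S])
    qed
    have tab3: "tabulated (Suc v) F3"
      unfolding tabulated_def
    proof (intro allI impI)
      fix S assume S: "S \<subseteq> {..<x}"
      have "F3 9 (enc S) = F2 2 (enc S)" "F3 2 (enc S) = F2 2 (enc S)" "F3 3 (enc S) = 0"
        by (simp_all add: F3_def fold_copy[OF S])
      then show "F3 9 (enc S) = dp E xs (Suc v) S \<and> F3 2 (enc S) = dp E xs (Suc v) S \<and> F3 3 (enc S) = 0"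
        by (simp only: new[OF S])
    qed
    have other3: "\<forall>f. f \<notin> {2, 3, 9} \<longrightarrow> F3 f = F f"
      using other by (simp add: F3_def F2_def F1_def)
    have ents: "entries F1 (splits x)" "entries F2 (splits x)"
      using F0(1) by (simp_all add: entries_def F1_def F2_def)
    \<comment> \<open>The sum stays below \<open>v + 1\<close> times the weight bound:
      \<open>v\<close> rounds and one further weight.\<close>
    have bound: "F1 3 (enc A) + F1 9 (enc B) < W" if "(A, B) \<in> set (splits x)" for A B
    proof -
      have AB: "A \<subseteq> {..<x}" "B \<subseteq> {..<x}" using that by (auto simp: in_splits)
      have "weight E xs v A + dp E xs v B \<le> 2 * 2 ^ x + v * (2 * 2 ^ x)"
        by (intro add_mono weight_bound dp_bound AB)
      also have "\<dots> = (2 * 2 ^ x) * (v + 1)" by simp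
      also have "\<dots> \<le> (2 * 2 ^ x) * (n + 1)" using v by (intro mult_left_mono) auto
      also have "\<dots> < W" using pow2_x(2) W by linarith
      finally show ?thesis by (simp only: weight[OF AB(1)] old[OF AB(2)])
    qed
    have s1: "std r1" "r1 rLen = 3 ^ x" using std r1(2) by (auto simp: std_def)
    have c: "(0 < r1 rB) = (v \<in> set xs)" using r1(1) bitval_pos_iff[OF distinct_xs] by simp
    show ?thesis
      unfolding wp_Seq
    proof (rule wp_weight[OF s1 mask F0(1), unfolded c], fold F1_def)
      fix t2 r2
      assume t2: "t2 \<le> t1 + 2 + 82 * 3 ^ x" and r2: "\<forall>x. x \<noteq> rI \<longrightarrow> x \<notin> scratch \<longrightarrow> r2 x = r1 x"
      then have s2: "std r2" "r2 rLen = 3 ^ x" using s1 by (auto simp: std_def)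
      show "wp W (for_loop rOne rI rLen max_body) (wp W (for_loop rOne rI rLen copy_body) ?Q) t2 r2 (lay F1)"
      proof (rule wp_max[OF s2 ents(1) bound], assumption, fold F2_def)
        fix t3 r3
        assume t3: "t3 \<le> t2 + 2 + 82 * 3 ^ x" and r3: "\<forall>x. x \<noteq> rI \<longrightarrow> x \<notin> scratch \<longrightarrow> r3 x = r2 x"
        then have s3: "std r3" "r3 rLen = 3 ^ x" using s2 by (auto simp: std_def)
        show "wp W (for_loop rOne rI rLen copy_body) ?Q t3 r3 (lay F2)"
        proof (rule wp_copy[OF s3 ents(2)], fold F3_def)
          fix t4 r4
          assume t4: "t4 \<le> t3 + 2 + 82 * 3 ^ x" and r4: "\<forall>x. x \<noteq> rI \<longrightarrow> x \<notin> scratch \<longrightarrow> r4 x = r3 x"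
          have "t4 \<le> t' + (38 + 26 * l + 246 * 3 ^ x)"
            using t1 t2 t3 t4 by linarith
          moreover have "\<forall>x. x \<notin> scratch2 \<longrightarrow> r4 x = r' x"
            using r1(2) r2 r3 r4 by simp
          ultimately show "?Q t4 r4 (lay F3)" using tab3 other3 by blast
        qed
      qed
    qed
  qed
  have "wp W (IfLess rZero rB (Sub rMask rP rOne) scan) (wp W ?sweeps ?Q) (t' + 8)
    (r'(rTm := base + 16 * v, rTj := 0, rB := bitval xs v)) (lay F0)"
  proof (cases "v \<in> set xs")
    case True
    then have "0 < bitval xs v" using bitval_pos_iff[OF distinct_xs] by blast
    moreover have "wp W ?sweeps ?Q (t' + 10)
      (r'(rTm := base + 16 * v, rTj := 0, rB := bitval xs v, rMask := 2 ^ x - 1)) (lay F0)"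
      using True by (intro sweeps) (simp_all add: enc_full)
    moreover have "wp W (IfLess rZero rB (Sub rMask rP rOne) scan) P (t' + 8)
        (r'(rTm := base + 16 * v, rTj := 0, rB := bitval xs v)) (lay F0)"
      if "0 < bitval xs v" "P (t' + 10)
        (r'(rTm := base + 16 * v, rTj := 0, rB := bitval xs v, rMask := 2 ^ x - 1)) (lay F0)" for P
      using that std by (simp add: std_def add.commute)
    ultimately show ?thesis by blast
  next
    case False
    then have 0: "bitval xs v = 0" by (rule bitval_notin)
    have "wp W scan (wp W ?sweeps ?Q) (t' + 9)
      (r'(rTm := base + 16 * v, rTj := 0, rB := bitval xs v)) (lay F0)"
    proof (rule wp_scan[of _ v F0, OF _ _ v scan_bound[of v F0, OF v F0(2)]])
      fix t1 r1
      assume "t1 \<le> t' + 9 + 12 + 13 * length (adj ! v)"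
        and "r1 rMask = sum_list (map (F0 0) (adj ! v))"
        and "\<forall>x. x \<notin> {rMask, rA, rE, rU, rB2, rTm, rTj} \<longrightarrow>
          r1 x = (r'(rTm := base + 16 * v, rTj := 0, rB := bitval xs v)) x"
      with False show "wp W ?sweeps ?Q t1 r1 (lay F0)"
        using degree_le_cover[OF v False] sum_bitval[OF v] F0(2) by (intro sweeps) simp_all
    qed (use std r'(2) in \<open>simp_all add: std_def\<close>)
    moreover have "wp W (IfLess rZero rB (Sub rMask rP rOne) scan) P (t' + 8)
        (r'(rTm := base + 16 * v, rTj := 0, rB := bitval xs v)) (lay F0)"
      if "wp W scan P (t' + 9) (r'(rTm := base + 16 * v, rTj := 0, rB := bitval xs v)) (lay F0)" for P
      using that std 0 by (simp add: std_def add.commute)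
    ultimately show ?thesis by blast
  qed
  then show "wp W (get 0 rB rV ;; IfLess rZero rB (Sub rMask rP rOne) scan ;; ?sweeps) ?Q t' r' m'"
    unfolding wp_Seq m' using std r'(2) addr F0(2) by (subst wp_get) (simp_all add: std_def)
next
  fix t' r' m'
  assume t': "t' \<le> t + 2 + (\<Sum>v<n. 38 + 26 * l + 246 * 3 ^ x + 2)"
    and "\<exists>F'. m' = lay F' \<and> tabulated n F' \<and> (\<forall>f. f \<notin> {2, 3, 9} \<longrightarrow> F' f = F f)"
    and r': "\<forall>x. x \<noteq> rV \<longrightarrow> x \<notin> scratch2 \<longrightarrow> r' x = r x"
  then obtain F' where "m' = lay F'" "tabulated n F'" by blast
  moreover have "t' \<le> t + 2 + n * (40 + 26 * l + 246 * 3 ^ x)"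
    using t' by (simp add: algebra_simps)
  ultimately show "Q t' r' m'" using Q r' by blast
qed (use r in \<open>auto simp: std_def\<close>)

lemma wp_answer:
  assumes r: "std r" "r rP = 2 ^ x" and F: "tabulated n F"
    and Q: "\<And>t' r' m'. \<lbrakk>t' \<le> t + 11; r' 0 = (if cluster_deletion {..<n} E k then 1 else 0)\<rbrakk> \<Longrightarrow> Q t' r' m'"
  shows "wp W answer Q t r (lay F)"
proof -
  have "base + 16 * (2 ^ x - 1) + 9 < W" "1 < W"
    using W pow2_x(1) by linarith+
  moreover have "F 9 (2 ^ x - 1) = dp E xs n {..<x}"
    using F by (metis enc_full order_refl tabulated_def)
  moreover have "cluster_deletion {..<n} E k \<longleftrightarrow> \<not> dp E xs n {..<x} < l"
    using cluster_deletion_iff_dp[OF graph distinct_xs xs_less cover, of k] length_xs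
    by (auto simp: l_def)
  ultimately show ?thesis
    using r by (auto simp: answer_def wp_rw std_def intro!: Q)
qed

end

section \<open>Greedy matching\<close>

text \<open>Edges are stored as consecutive pairs, so that the list of endpoints itself can serve as
  the cover, in the order in which the bits are assigned.\<close>

definition matching_list :: "nat set set \<Rightarrow> nat \<Rightarrow> nat list \<Rightarrow> bool" where
  "matching_list E c ys \<longleftrightarrow>
     distinct ys \<and> length ys = 2 * c \<and> (\<forall>j<c. {ys ! (2 * j), ys ! (2 * j + 1)} \<in> E)"

lemma matching_list_snoc:
  assumes "matching_list E c ys" "{v, u} \<in> E" "v \<noteq> u" "v \<notin> set ys" "u \<notin> set ys"
  shows "matching_list E (Suc c) (ys @ [v] @ [u])"
  using assms by (auto simp: matching_list_def nth_append less_Suc_eq)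

lemma matching_list_vertices:
  assumes "simple_graph V E" "matching_list E c ys"
  shows "set ys \<subseteq> V"
proof
  fix u assume "u \<in> set ys"
  then obtain i where i: "i < 2 * c" "u = ys ! i"
    using assms(2) by (auto simp: matching_list_def in_set_conv_nth)
  define j where "j = i div 2"
  have "j < c" "i = 2 * j \<or> i = 2 * j + 1" using i(1) by (auto simp: j_def)
  moreover from this have "{ys ! (2 * j), ys ! (2 * j + 1)} \<in> E"
    using assms(2) by (simp add: matching_list_def)
  note edgeD[OF assms(1) this]
  ultimately show "u \<in> V" using i(2) by auto
qed

text \<open>The matching edges are disjoint cliques of two vertices, contributing one edge
  each.\<close>

lemma cluster_deletion_if_matching:
  assumes G: "simple_graph V E" and "matching_list E c ys" "card E - k \<le> c"
  shows "cluster_deletion V E k"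
proof (rule cluster_deletion_if_disjoint_cliques[OF G, of "{..<c}" "\<lambda>j. {ys ! (2 * j), ys ! (2 * j + 1)}"])
  have ys: "distinct ys" "length ys = 2 * c" and E: "\<And>j. j < c \<Longrightarrow> {ys ! (2 * j), ys ! (2 * j + 1)} \<in> E"
    using assms(2) by (auto simp: matching_list_def)
  have ne: "ys ! (2 * j) \<noteq> ys ! (2 * j + 1)" if "j < c" for j
    using edgeD(1)[OF G E[OF that]] .
  then have "card {ys ! (2 * j), ys ! (2 * j + 1)} choose 2 = 1" if "j < c" for j
    using that by (simp add: card_insert_if numeral_2_eq_2)
  then show "card E - k \<le> (\<Sum>j<c. card {ys ! (2 * j), ys ! (2 * j + 1)} choose 2)"
    using assms(3) by simp
  fix i assume "i \<in> {..<c}"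
  then have i: "i < c" by simp
  show "{ys ! (2 * i), ys ! (2 * i + 1)} \<subseteq> V"
    using edgeD[OF G E[OF i]] by simp
  show "clique_edges {ys ! (2 * i), ys ! (2 * i + 1)} \<subseteq> E"
    using E[OF i] unfolding clique_edges_subset_iff by (auto simp: insert_commute)
  fix j assume "j \<in> {..<c}" "i \<noteq> j"
  then show "{ys ! (2 * i), ys ! (2 * i + 1)} \<inter> {ys ! (2 * j), ys ! (2 * j + 1)} = {}"
    using ys i by (auto simp: nth_eq_iff_index_eq)
qed simp

text \<open>\<open>rP\<close> is the bit of the next endpoint, hence two doublings per edge; a
  nonzero field 0 marks a matched vertex. Setting \<open>rE\<close> to 0 leaves the loop after a
  success.\<close>

definition match_vertex :: com where
  "match_vertex = bounds ;;
     WhileLess rA rE (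
       Load rU rA ;; Add rA rA rOne ;; get 0 rB2 rU ;;
       IfLess rZero rB2 Skip (
         put 0 rV rP ;; Add rP rP rP ;; put 0 rU rP ;; Add rP rP rP ;; Add rC rC rOne ;; Copy rE rZero))"

text \<open>Setting \<open>rLim\<close> to 0 ends the search at \<open>l\<close> edges, which also
  keeps \<open>rP\<close> within \<open>4 ^ l\<close>.\<close>

definition matching_phase :: com where
  "matching_phase = Const rP 1 ;; Const rC 0 ;; Const rV 0 ;; Copy rLim rN ;;
     WhileLess rV rLim (
       get 0 rB rV ;; IfLess rZero rB Skip match_vertex ;; Add rV rV rOne ;;
       IfLess rC rL Skip (Copy rLim rZero))"

abbreviation (input) "bits ys \<equiv> ((\<lambda>_ _. 0) :: nat \<Rightarrow> nat \<Rightarrow> nat)(0 := bitval ys)"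

context machine_input
begin

lemma pow4: "c \<le> l \<Longrightarrow> (2::nat) ^ (2 * c) \<le> M"
proof -
  assume "c \<le> l"
  then have "(4::nat) ^ c \<le> 4 ^ l" by (intro power_increasing) auto
  also have "\<dots> \<le> 9 ^ l" by (intro power_mono) auto
  also have "\<dots> * 1 \<le> 9 ^ l * (n + 1)" by (intro mult_left_mono) auto
  finally show ?thesis by (simp add: M_def power_mult)
qed

abbreviation (input) "match_regs \<equiv> {rA, rE, rU, rB2, rTm, rTj, rP, rC}"

text \<open>The neighbours passed over are distinct and matched, so there are at most
  \<open>2 * c\<close> of them, however long the list is.\<close>

lemma wp_match_vertex:
  assumes r: "std r" "r rV = v" "v < n" "r rC = c" "r rP = 2 ^ (2 * c)"
    and ys: "matching_list E c ys" "v \<notin> set ys" "c < l"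
    and Q: "\<And>t' r' c' ys'. \<lbrakk>t' \<le> t + 5 + 40 * (2 * l); matching_list E c' ys'; c' \<le> l; set ys \<subseteq> set ys';
        v \<in> set ys' \<or> (\<forall>u. {v, u} \<in> E \<longrightarrow> u \<in> set ys'); r' rC = c'; r' rP = 2 ^ (2 * c');
        \<forall>x. x \<notin> match_regs \<longrightarrow> r' x = r x\<rbrakk> \<Longrightarrow> Q t' r' (lay (bits ys'))"
  shows "wp W match_vertex Q t r (lay (bits ys))"
proof -
  let ?as = "adj ! v"
  let ?body = "Load rU rA ;; Add rA rA rOne ;; get 0 rB2 rU ;;
       IfLess rZero rB2 Skip (
         put 0 rV rP ;; Add rP rP rP ;; put 0 rU rP ;; Add rP rP rP ;; Add rC rC rOne ;; Copy rE rZero)"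
  define searching where "searching i r' m' \<longleftrightarrow> m' = lay (bits ys) \<and> i \<le> length ?as \<and> set (take i ?as) \<subseteq> set ys \<and>
      r' rA = start v + i \<and> r' rE = start v + length ?as \<and> r' rC = c \<and> r' rP = 2 ^ (2 * c)" for i r' m'
  define found where "found r' m' \<longleftrightarrow> (\<exists>u. m' = lay (bits (ys @ [v] @ [u])) \<and> u \<notin> set ys \<and> {v, u} \<in> E \<and>
      r' rE = 0 \<and> r' rC = Suc c \<and> r' rP = 2 ^ (2 * Suc c))" for r' m'
  let ?I = "\<lambda>i t' r' m'. t' \<le> t + 4 + 40 * i \<and> i \<le> 2 * l \<and>
    (searching i r' m' \<or> found r' m') \<and> (\<forall>x. x \<notin> match_regs \<longrightarrow> r' x = r x)"
  have dist: "distinct ?as" "set ?as = {u. {v, u} \<in> E}"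
    using adj_set[OF r(3)] by auto
  have len_ys: "distinct ys" "length ys = 2 * c"
    using ys(1) by (auto simp: matching_list_def)
  have few: "i \<le> 2 * c" if "searching i r' m'" for i r' m'
  proof -
    have "card (set (take i ?as)) \<le> card (set ys)"
      using that by (intro card_mono) (auto simp: searching_def)
    then show ?thesis
      using that dist(1) len_ys by (simp add: distinct_card searching_def)
  qed
  have "wp W (WhileLess rA rE ?body) Q (t + 4) (r(rA := start v, rE := start (Suc v))) (lay (bits ys))"
  proof (rule wp_while[of ?I _ _ _ _ _ "2 * l"])
    show "?I 0 (t + 4) (r(rA := start v, rE := start (Suc v))) (lay (bits ys))"
      using r by (auto simp: searching_def start_Suc)
  next
    fix i t' r' m'
    assume I: "?I i t' r' m'" and "r' rA < r' rE"
    then have s: "searching i r' m'" and keep: "\<forall>x. x \<notin> match_regs \<longrightarrow> r' x = r x"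
      by (auto simp: found_def)
    with \<open>r' rA < r' rE\<close> have i: "i < length ?as" by (simp add: searching_def)
    have il: "Suc i \<le> 2 * l" using few[OF s] ys(3) by simp
    let ?u = "?as ! i"
    have u: "?u < n" "{v, ?u} \<in> E" "?u \<noteq> v"
      using adj_less[OF r(3)] i dist(2) nth_mem[OF i] edgeD(1)[OF graph] by fastforce+
    have std: "std r'" "r' rV = v" using r keep by (auto simp: std_def)
    have loads: "start v + i < base" "lay (bits ys) (start v + i) = ?u"
      using lay_adj[OF r(3) i] by auto
    have addr: "base + 16 * v < W" "base + 16 * ?u < W" "base < W"
      using r(3) u(1) n_less W by simp_all
    show "i < 2 * l \<and> wp W ?body (?I (Suc i)) (t' + 1) r' m'"
    proof (cases "?u \<in> set ys")
      case True
      then have "searching (Suc i) r'' (lay (bits ys))"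
        if "r'' rA = Suc (start v + i)" "r'' rE = r' rE" "r'' rC = r' rC" "r'' rP = r' rP" for r''
        using s i that by (auto simp: searching_def take_Suc_conv_app_nth)
      moreover have "0 < bitval ys ?u" using bitval_pos_iff[OF len_ys(1)] True by simp
      ultimately show ?thesis
        using s std loads addr il keep I
        by (auto simp: searching_def[of i] wp_rw std_def)
    next
      case False
      have b: "bitval (ys @ [v] @ [?u]) = (bitval ys)(v := 2 ^ (2 * c), ?u := 2 ^ (2 * c) + 2 ^ (2 * c))"
      proof -
        have double: "(2::nat) ^ (2 * c) + 2 ^ (2 * c) = 2 * 2 ^ (2 * c)" by simp
        show ?thesis
          using bitval_snoc[OF ys(2)] bitval_snoc[of ?u "ys @ [v]"] False u(3) len_ys(2)
          by (simp add: double)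
      qed
      have found: "found r'' (lay (bits (ys @ [v] @ [?u])))"
        if "r'' rE = 0" "r'' rC = Suc c" "r'' rP = 2 ^ (2 * c) + 2 ^ (2 * c) + (2 ^ (2 * c) + 2 ^ (2 * c))" for r''
        using that False u(2) unfolding found_def by (intro exI[of _ ?u]) simp
      have "4 * 2 ^ (2 * c) < W"
        using pow4[of "Suc c"] ys(3) W by simp
      moreover have "bitval ys ?u = 0" using False by (rule bitval_notin)
      moreover have "c + 1 < W"
      proof -
        have "c < 2 ^ (2 * c)" by (rule less_le_trans[OF less_exp]) (intro power_increasing, auto)
        then show ?thesis using pow4[of c] ys(3) W by simp
      qed
      ultimately have lift: "wp W ?body P (t' + 1) r' m'"
        if "\<And>t'' r''. \<lbrakk>t'' \<le> t' + 40; r'' rE = 0; r'' rC = Suc c;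
            r'' rP = 2 ^ (2 * c) + 2 ^ (2 * c) + (2 ^ (2 * c) + 2 ^ (2 * c));
            \<forall>x. x \<notin> match_regs \<longrightarrow> r'' x = r' x\<rbrakk> \<Longrightarrow> P t'' r'' (lay (bits (ys @ [v] @ [?u])))" for P
        using s std loads addr
        by (simp add: searching_def[of i] wp_rw std_def b that[unfolded b])
      have "wp W ?body (?I (Suc i)) (t' + 1) r' m'"
        by (rule lift) (use found I il keep in auto)
      with il show ?thesis by simp
    qed
  next
    fix i t' r' m'
    assume I: "?I i t' r' m'" and "\<not> r' rA < r' rE"
    have t': "t' + 1 \<le> t + 5 + 40 * (2 * l)" using I by auto
    from I consider "searching i r' m'" | "found r' m'" by blast
    then show "Q (t' + 1) r' m'"
    proof cases
      case 1
      then have "i = length ?as" using \<open>\<not> r' rA < r' rE\<close> by (simp add: searching_def)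
      then have "{v, u} \<in> E \<longrightarrow> u \<in> set ys" for u
        using 1 dist(2) by (auto simp: searching_def)
      moreover have "m' = lay (bits ys)" using 1 by (simp add: searching_def)
      ultimately show ?thesis
        using 1 t' ys I by (simp only:) (intro Q[of _ c ys], auto simp: searching_def)
    next
      case 2
      then obtain u where u: "m' = lay (bits (ys @ [v] @ [u]))" "u \<notin> set ys" "{v, u} \<in> E"
        by (auto simp: found_def)
      have "matching_list E (Suc c) (ys @ [v] @ [u])"
        using u ys edgeD(1)[OF graph u(3)] by (intro matching_list_snoc) auto
      then show ?thesis
        unfolding u(1) using 2 t' ys I by (intro Q[of _ "Suc c" "ys @ [v] @ [u]"]) (auto simp: found_def)
    qed
  qed
  then show ?thesis
    using r by (simp add: match_vertex_def wp_bounds)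
qed

lemma wp_matching_phase:
  assumes r: "std r"
    and Q: "\<And>t' r' c ys. \<lbrakk>t' \<le> t + 5 + n * (20 + 80 * l); matching_list E c ys; c \<le> l;
        c < l \<longrightarrow> (\<forall>u v. {u, v} \<in> E \<longrightarrow> u \<in> set ys \<or> v \<in> set ys); r' rC = c; r' rP = 2 ^ (2 * c); std r'\<rbrakk>
      \<Longrightarrow> Q t' r' (lay (bits ys))"
  shows "wp W matching_phase Q t r (lay (\<lambda>_ _. 0))"
proof -
  let ?body = "get 0 rB rV ;; IfLess rZero rB Skip match_vertex ;; Add rV rV rOne ;;
       IfLess rC rL Skip (Copy rLim rZero)"
  let ?I = "\<lambda>v t' r' m'. v \<le> n \<and> t' \<le> t + 4 + v * (20 + 80 * l) \<and> std r' \<and> (\<exists>c ys. m' = lay (bits ys) \<and>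
      matching_list E c ys \<and> c \<le> l \<and> r' rC = c \<and> r' rP = 2 ^ (2 * c) \<and> r' rV = v \<and> r' rLim = (if c < l then n else 0) \<and>
      (\<forall>u<v. \<forall>w. {u, w} \<in> E \<longrightarrow> u \<in> set ys \<or> w \<in> set ys))"
  have "0 < l" using k by (simp add: l_def)
  have bits0: "bits [] = (\<lambda>_ _. 0)" by (auto simp: bitval_def fun_eq_iff)
  have "wp W (WhileLess rV rLim ?body) Q (t + 4) (r(rP := 1, rC := 0, rV := 0, rLim := n)) (lay (\<lambda>_ _. 0))"
  proof (rule wp_while[of ?I _ _ _ _ _ n])
    have "matching_list E 0 []" by (simp add: matching_list_def)
    then show "?I 0 (t + 4) (r(rP := 1, rC := 0, rV := 0, rLim := n)) (lay (\<lambda>_ _. 0))"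
      using r \<open>0 < l\<close> bits0 by (auto simp: std_def intro!: exI[of _ "[]"])
  next
    fix v t' r' m'
    assume I: "?I v t' r' m'" and lt: "r' rV < r' rLim"
    then obtain c ys where m': "m' = lay (bits ys)" and ys: "matching_list E c ys" and c: "r' rC = c" "r' rP = 2 ^ (2 * c)"
      and v: "r' rV = v" and lim: "r' rLim = (if c < l then n else 0)"
      and covered: "\<forall>u<v. \<forall>w. {u, w} \<in> E \<longrightarrow> u \<in> set ys \<or> w \<in> set ys"
      by blast
    have vn: "v < n" "c < l" "r' rLim = n" using lt v lim by (auto split: if_splits)
    have std: "std r'" and t': "t' \<le> t + 4 + v * (20 + 80 * l)" using I by auto
    have addr: "base + 16 * v < W" "v + 1 < W" using vn n_less W by simp_all
    have dist: "distinct ys" using ys by (simp add: matching_list_def)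
    have step: "wp W (Add rV rV rOne ;; IfLess rC rL Skip (Copy rLim rZero)) (?I (Suc v)) t1 r1 (lay (bits ys1))"
      if "t1 \<le> t' + 16 + 80 * l" "matching_list E c1 ys1" "c1 \<le> l" "set ys \<subseteq> set ys1"
        "v \<in> set ys1 \<or> (\<forall>u. {v, u} \<in> E \<longrightarrow> u \<in> set ys1)" "r1 rC = c1" "r1 rP = 2 ^ (2 * c1)"
        "\<forall>x. x \<notin> insert rB match_regs \<longrightarrow> r1 x = r' x" for t1 r1 c1 ys1
    proof -
      have cov: "\<forall>u<Suc v. \<forall>w. {u, w} \<in> E \<longrightarrow> u \<in> set ys1 \<or> w \<in> set ys1"
        using covered that(4,5) by (metis less_Suc_eq subset_iff)
      have time: "t1 + 3 \<le> t + 4 + Suc v * (20 + 80 * l)" using that(1) t' by simp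
      have std1: "std r1" "r1 rV = v" "r1 rLim = n" using std that(8) v vn(3) by (auto simp: std_def)
      have inv: "?I (Suc v) t2 r2 (lay (bits ys1))"
        if "t2 \<le> t1 + 3" "std r2" "r2 rC = c1" "r2 rP = 2 ^ (2 * c1)" "r2 rV = Suc v" "r2 rLim = (if c1 < l then n else 0)"
        for t2 r2
        using that cov time vn(1) \<open>matching_list E c1 ys1\<close> \<open>c1 \<le> l\<close>
        by (intro conjI exI[of _ c1] exI[of _ ys1]) (auto simp del: mult_Suc)
      have lift: "wp W (Add rV rV rOne ;; IfLess rC rL Skip (Copy rLim rZero)) P t1 r1 m"
        if "c1 < l \<Longrightarrow> P (t1 + 3) (r1(rV := Suc v)) m"
          "\<not> c1 < l \<Longrightarrow> P (t1 + 3) (r1(rV := Suc v, rLim := 0)) m" for P m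
      proof -
        have three: "Suc (Suc (Suc t1)) = t1 + 3" by simp
        show ?thesis
          using that std1 \<open>r1 rC = c1\<close> addr(2) by (simp add: std_def three)
      qed
      show ?thesis
        by (rule lift; rule inv) (use std1 that(6,7) in \<open>simp_all add: std_def\<close>)
    qed
    have "wp W ?body (?I (Suc v)) (t' + 1) r' (lay (bits ys))"
    proof (cases "v \<in> set ys")
      case True
      then have pos: "0 < bitval ys v" using bitval_pos_iff[OF dist] by blast
      have "wp W ?body P (t' + 1) r' (lay (bits ys))"
        if "wp W (Add rV rV rOne ;; IfLess rC rL Skip (Copy rLim rZero)) P (t' + 11)
          (r'(rTm := base + 16 * v, rTj := 0, rB := bitval ys v)) (lay (bits ys))" for P
        using that pos std v addr by (simp add: wp_rw std_def add.commute del: wp_IfLess wp_Seq add: wp_IfLess[of W rZero] wp_Seq[of W "get 0 rB rV"] wp_Seq[of W "IfLess rZero rB Skip match_vertex"])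
      moreover have "wp W (Add rV rV rOne ;; IfLess rC rL Skip (Copy rLim rZero)) (?I (Suc v)) (t' + 11)
          (r'(rTm := base + 16 * v, rTj := 0, rB := bitval ys v)) (lay (bits ys))"
        using True ys vn c by (intro step[of _ c]) auto
      ultimately show ?thesis by blast
    next
      case False
      then have zero: "bitval ys v = 0" by (rule bitval_notin)
      have "wp W ?body P (t' + 1) r' (lay (bits ys))"
        if "wp W match_vertex (wp W (Add rV rV rOne ;; IfLess rC rL Skip (Copy rLim rZero)) P) (t' + 10)
          (r'(rTm := base + 16 * v, rTj := 0, rB := 0)) (lay (bits ys))" for P
        using that zero std v addr by (simp add: wp_rw std_def add.commute del: wp_IfLess wp_Seq add: wp_IfLess[of W rZero] wp_Seq[of W "get 0 rB rV"] wp_Seq[of W "IfLess rZero rB Skip match_vertex"])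
      moreover have "wp W match_vertex (wp W (Add rV rV rOne ;; IfLess rC rL Skip (Copy rLim rZero)) (?I (Suc v))) (t' + 10)
          (r'(rTm := base + 16 * v, rTj := 0, rB := 0)) (lay (bits ys))"
      proof (rule wp_match_vertex[OF _ _ vn(1) _ _ ys False vn(2)])
        fix t1 r1 c1 ys1
        assume "t1 \<le> t' + 10 + 5 + 40 * (2 * l)" "matching_list E c1 ys1" "c1 \<le> l" "set ys \<subseteq> set ys1"
          "v \<in> set ys1 \<or> (\<forall>u. {v, u} \<in> E \<longrightarrow> u \<in> set ys1)" "r1 rC = c1" "r1 rP = 2 ^ (2 * c1)"
          "\<forall>x. x \<notin> match_regs \<longrightarrow> r1 x = (r'(rTm := base + 16 * v, rTj := 0, rB := 0)) x"
        then show "wp W (Add rV rV rOne ;; IfLess rC rL Skip (Copy rLim rZero)) (?I (Suc v)) t1 r1 (lay (bits ys1))"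
          by (intro step[of _ c1]) auto
      qed (use std v c in \<open>auto simp: std_def\<close>)
      ultimately show ?thesis by blast
    qed
    with vn(1) m' show "v < n \<and> wp W ?body (?I (Suc v)) (t' + 1) r' m'" by simp
  next
    fix v t' r' m'
    assume I: "?I v t' r' m'" and nlt: "\<not> r' rV < r' rLim"
    then obtain c ys where m': "m' = lay (bits ys)" and ys: "matching_list E c ys" "c \<le> l"
      and c: "r' rC = c" "r' rP = 2 ^ (2 * c)"
      and v: "r' rV = v" and lim: "r' rLim = (if c < l then n else 0)"
      and covered: "\<forall>u<v. \<forall>w. {u, w} \<in> E \<longrightarrow> u \<in> set ys \<or> w \<in> set ys"
      by blast
    have "v * (20 + 80 * l) \<le> n * (20 + 80 * l)" using I by (intro mult_right_mono) auto
    then have t': "t' + 1 \<le> t + 5 + n * (20 + 80 * l)" using I by linarith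
    \<comment> \<open>With fewer than \<open>l\<close> edges \<open>rLim\<close> still equals
      \<open>n\<close>, so all vertices have been treated.\<close>
    have cov: "c < l \<longrightarrow> (\<forall>u w. {u, w} \<in> E \<longrightarrow> u \<in> set ys \<or> w \<in> set ys)"
    proof (intro impI allI)
      fix u w assume "c < l" and uw: "{u, w} \<in> E"
      then have "n \<le> v" using nlt v lim by simp
      then have "u < v" using edgeD(2)[OF graph uw] by simp
      then show "u \<in> set ys \<or> w \<in> set ys" using covered uw by blast
    qed
    show "Q (t' + 1) r' m'"
      unfolding m' using t' ys cov c I by (intro Q) blast+
  qed
  moreover have "Suc (Suc (Suc (Suc t))) = t + 4" by simp
  note four = this
  ultimately show ?thesis
    using r W by (simp add: matching_phase_def std_def four)
qed

end

section \<open>The complete algorithm\<close>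

definition solver :: com where
  "solver =
     Const rOne 1 ;; Load rV rOne ;; Const rA 2 ;; Load rB rA ;;
     IfLess rB rV
       (Sub rL rV rB ;; Const rZero 0 ;; Const rThree 3 ;; Load rN rZero ;; Add rA rThree rN ;; Load rBase rA ;;
        matching_phase ;;
        IfLess rC rL (build_splits ;; count_phase ;; round_phase ;; answer) (Const 0 1))
       (Const 0 1)"

lemma (in cover_input) wp_dynamic_program:
  assumes r: "std r" "r rP = 2 ^ x"
    and Q: "\<And>t' r' m'. \<lbrakk>t' \<le> t + 18 + 200 * 3 ^ x + x * (40 + 13 * n + 82 * 3 ^ x) + n * 22 +
        n * (40 + 26 * l + 246 * 3 ^ x);
        r' 0 = (if cluster_deletion {..<n} E k then 1 else 0)\<rbrakk> \<Longrightarrow> Q t' r' m'"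
  shows "wp W (build_splits ;; count_phase ;; round_phase ;; answer) Q t r (lay (bits xs))"
  unfolding wp_Seq
proof (rule wp_build_splits[OF r])
  \<comment> \<open>Zeroed fields already describe the table with the single pair of empty
    sets.\<close>
  have "(0::nat) choose 2 = 0" by (rule binomial_eq_0) simp
  then show "entries (bits xs) (splits 0)" by (simp add: entries_def)
  fix t1 r1 F1
  assume t1: "t1 \<le> t + 3 + 200 * 3 ^ x" and F1: "entries F1 (splits x)" and len: "r1 rLen = 3 ^ x"
    and other: "\<forall>f. f \<notin> {5, 6, 7, 8} \<longrightarrow> F1 f = bits xs f"
    and r1: "\<forall>x. x \<notin> {rI, rLen, rLen0, rBB} \<union> scratch \<longrightarrow> r1 x = r x"
  have std1: "std r1" "r1 rP = 2 ^ x" using r r1 by (auto simp: std_def)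
  have F1': "F1 0 = bitval xs" "F1 4 = (\<lambda>_. 0)" using other by simp_all
  show "wp W count_phase (wp W round_phase (wp W answer Q)) t1 r1 (lay F1)"
  proof (rule wp_count_phase[OF std1(1) len F1 F1'])
    fix t2 r2 h
    assume t2: "t2 \<le> t1 + 2 + x * (40 + 13 * n + 82 * 3 ^ x) + n * 22" and h: "counted n h"
      and r2: "\<forall>x. x \<noteq> rV \<longrightarrow> x \<notin> scratch2 \<longrightarrow> r2 x = r1 x"
    have std2: "std r2" "r2 rP = 2 ^ x" "r2 rLen = 3 ^ x" using std1 len r2 by (auto simp: std_def)
    show "wp W round_phase (wp W answer Q) t2 r2 (lay (F1(4 := h)))"
    proof (rule wp_round_phase[OF std2(1,3,2)])
      show "entries (F1(4 := h)) (splits x)" using F1 by (simp add: entries_def)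
      show "tabulated 0 (F1(4 := h))" using other by (simp add: tabulated_def)
      fix t3 r3 F3
      assume t3: "t3 \<le> t2 + 2 + n * (40 + 26 * l + 246 * 3 ^ x)" and F3: "tabulated n F3"
        and r3: "\<forall>x. x \<noteq> rV \<longrightarrow> x \<notin> scratch2 \<longrightarrow> r3 x = r2 x"
      have std3: "std r3" "r3 rP = 2 ^ x" using std2 r3 by (auto simp: std_def)
      show "wp W answer Q t3 r3 (lay F3)"
      proof (rule wp_answer[OF std3 F3])
        fix t4 r4 m4
        assume "t4 \<le> t3 + 11" "(r4 :: nat \<Rightarrow> nat) 0 = (if cluster_deletion {..<n} E k then 1 else (0::nat))"
        then show "Q t4 r4 m4" using t1 t2 t3 by (intro Q) linarith+
      qed
    qed (use F1' h in simp_all)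
  qed
qed

section \<open>Estimates for time and word size\<close>

lemma time_bound:
  fixes l n x Z :: nat
  assumes l: "0 < l" and n: "0 < n" and x: "x \<le> 2 * l" and Z: "Z \<le> 9 ^ l"
  shows "40 + n * (20 + 80 * l) + 200 * Z + x * (40 + 13 * n + 82 * Z) + n * 22 +
    n * (40 + 26 * l + 246 * Z) \<le> 2000 * (9 ^ l * l * n)"
proof -
  define T where "T = 9 ^ l * l * n"
  have one: "1 \<le> (9::nat) ^ l" by simp
  \<comment> \<open>Each monomial is compared with \<open>T\<close> factor by factor; missing
    factors are 1, by positivity of \<open>l\<close> and \<open>n\<close>.\<close>
  have le: "a * b * c \<le> T" if "a \<le> 9 ^ l" "b \<le> l" "c \<le> n" for a b c
    unfolding T_def using that by (intro mult_mono) auto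
  have "1 * 1 * 1 \<le> T" "1 * 1 * n \<le> T" "1 * l * 1 \<le> T" "1 * l * n \<le> T" "Z * 1 * 1 \<le> T" "Z * l * 1 \<le> T" "Z * 1 * n \<le> T"
    using l n one Z by (intro le; simp)+
  moreover have "x * (40 + 13 * n + 82 * Z) \<le> 2 * l * (40 + 13 * n + 82 * Z)"
    using x by (rule mult_right_mono) simp
  ultimately show ?thesis
    unfolding T_def[symmetric] by (simp add: algebra_simps)
qed

text \<open>Let \<open>z = 2 ^ l * (n + k + 2)\<close>. From
  \<open>9 ^ l \<le> 16 ^ l = (2 ^ l) ^ 4 \<le> z ^ 4\<close> and \<open>16 \<le> z ^ 2\<close> the
  main term is at most \<open>z ^ 7\<close>. The other terms are at most \<open>z ^ 2\<close> each,
  and \<open>4 \<le> z\<close> raises the exponent to 8.\<close>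

lemma word_bound_ge:
  assumes "0 < l"
  shows "n + 4 + n * n + 16 * (9 ^ l * (n + 1)) + 16 \<le> word_bound 8 n k l"
proof -
  define z where "z = 2 ^ l * (n + k + 2)"
  have two: "2 \<le> (2::nat) ^ l" using power_increasing[OF assms[THEN Suc_leI], of "2::nat"] by simp
  have "1 * (n + 2) \<le> z" "2 * 2 \<le> z" "2 ^ l * 1 \<le> z"
    unfolding z_def by (intro mult_mono two; simp)+
  then have z: "n + 2 \<le> z" "4 \<le> z" "2 ^ l \<le> z" by simp_all
  have "n + 4 + n * n \<le> (n + 2) * (n + 2)" by simp
  also have "\<dots> \<le> z * z" using z(1) by (intro mult_mono) auto
  finally have base: "n + 4 + n * n \<le> z ^ 2" by (simp add: power2_eq_square)
  have "4 * 4 \<le> z * z" using z(2) by (intro mult_mono) auto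
  then have c16: "16 \<le> z ^ 2" by (simp add: power2_eq_square)
  have "(9::nat) ^ l \<le> 16 ^ l" by (intro power_mono) auto
  also have "(16::nat) ^ l = (2 ^ l) ^ 4" by (simp add: power_mult[symmetric] mult.commute[of l] power_mult)
  also have "\<dots> \<le> z ^ 4" using z(3) by (intro power_mono) auto
  finally have "16 * (9 ^ l * (n + 1)) \<le> z ^ 2 * (z ^ 4 * z)"
    using c16 z(1) by (intro mult_mono) auto
  also have "\<dots> = z ^ 7" by (simp add: eval_nat_numeral)
  finally have M: "16 * (9 ^ l * (n + 1)) \<le> z ^ 7" .
  have "z ^ 2 \<le> z ^ 7" using z(2) by (intro power_increasing) auto
  with base c16 M have "n + 4 + n * n + 16 * (9 ^ l * (n + 1)) + 16 \<le> 4 * z ^ 7" by linarith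
  also have "\<dots> \<le> z * z ^ 7" using z(2) by (rule mult_right_mono) simp
  also have "\<dots> = z ^ 8" by (simp add: eval_nat_numeral)
  finally show ?thesis by (simp add: word_bound_def z_def)
qed

lemma length_concat_adjacency:
  assumes "simple_graph {..<n} E" "adjacency_lists n E adj"
  shows "length (concat adj) \<le> n * n"
proof -
  have "length ys \<le> n" if "ys \<in> set adj" for ys
  proof -
    from that assms(2) obtain v where v: "v < n" "ys = adj ! v"
      by (auto simp: in_set_conv_nth adjacency_lists_def)
    with assms(2) have "distinct ys" "set ys \<subseteq> {..<n}"
      using edgeD(3)[OF assms(1)] by (auto simp: adjacency_lists_def)
    then show ?thesis
      using card_mono[of "{..<n}" "set ys"] by (simp add: distinct_card)
  qed
  then have "sum_list (map length adj) \<le> sum_list (map (\<lambda>_. n) adj)"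
    by (intro sum_list_mono)
  with assms(2) show ?thesis
    by (simp add: length_concat sum_list_triv adjacency_lists_def)
qed

lemma (in machine_input) wp_solver:
  assumes Q: "\<And>t' r' m'. \<lbrakk>t' \<le> 2000 * (9 ^ l * l * n); r' 0 = (if cluster_deletion {..<n} E k then 1 else 0)\<rbrakk>
    \<Longrightarrow> Q t' r' m'"
  shows "wp W solver Q 0 (\<lambda>_. 0) m0"
proof -
  have l: "0 < l" using k by (simp add: l_def)
  \<comment> \<open>An edge exists, so \<open>n\<close> is positive like \<open>l\<close>, and the
    constant costs are absorbed by \<open>9 ^ l * l * n\<close>.\<close>
  have "E \<noteq> {}" using k by auto
  then obtain e where "e \<in> E" by blast
  then have "e \<subseteq> {..<n}" "card e = 2" using graph by (auto simp: simple_graph_def)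
  then have n: "0 < n" by (cases "n = 0") auto
  let ?r = "(\<lambda>_. 0)(rOne := 1, rV := card E, rB := k, rL := l, rZero := 0, rThree := 3, rN := n, rA := 3 + n, rBase := base)"
  have std: "std ?r" by (simp add: std_def)
  have "wp W matching_phase (wp W (IfLess rC rL (build_splits ;; count_phase ;; round_phase ;; answer) (Const 0 1)) Q)
    11 ?r (lay (\<lambda>_ _. 0))"
  proof (rule wp_matching_phase[OF std])
    fix t r c ys
    assume t: "t \<le> 11 + 5 + n * (20 + 80 * l)" and ys: "matching_list E c ys" "c \<le> l"
      and cover: "c < l \<longrightarrow> (\<forall>u v. {u, v} \<in> E \<longrightarrow> u \<in> set ys \<or> v \<in> set ys)"
      and c: "r rC = c" "r rP = 2 ^ (2 * c)" and r: "std r"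
    show "wp W (IfLess rC rL (build_splits ;; count_phase ;; round_phase ;; answer) (Const 0 1)) Q t r (lay (bits ys))"
    proof (cases "c < l")
      case True
      interpret cover_input l M base n E k adj W ys "2 * c"
        using True ys(1) cover matching_list_vertices[OF graph ys(1)]
        by unfold_locales (auto simp: matching_list_def l_def)
      have "wp W (build_splits ;; count_phase ;; round_phase ;; answer) Q (t + 1) r (lay (bits ys))"
      proof (rule wp_dynamic_program[OF r c(2)])
        fix t' r' m'
        assume "t' \<le> t + 1 + 18 + 200 * 3 ^ (2 * c) + 2 * c * (40 + 13 * n + 82 * 3 ^ (2 * c)) + n * 22 +
          n * (40 + 26 * l + 246 * 3 ^ (2 * c))"
          and ans: "(r' :: nat \<Rightarrow> nat) 0 = (if cluster_deletion {..<n} E k then 1 else (0::nat))"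
        moreover have "2 * c \<le> 2 * l" using True by simp
        note time_bound[OF l n this pow3_x(1)]
        ultimately show "Q t' r' m'" using t by (intro Q) linarith+
      qed
      with True c r show ?thesis by (simp only: wp_IfLess std_def if_True)
    next
      case False
      then have "cluster_deletion {..<n} E k"
        using cluster_deletion_if_matching[OF graph ys(1)] ys(2) by (simp add: l_def)
      moreover have "t + 2 \<le> 2000 * (9 ^ l * l * n)"
        using time_bound[OF l n, of 0 0] t by simp
      moreover have "1 < W" using W by simp
      ultimately show ?thesis
        using False c r by (auto simp: std_def intro!: Q)
    qed
  qed
  moreover have "m0 0 = n" "m0 1 = card E" "m0 2 = k" "m0 (3 + n) = base"
  proof -
    show "m0 0 = n" "m0 1 = card E" "m0 2 = k"
      by (simp_all add: m0_eq input_words_def base_def)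
    show "m0 (3 + n) = base"
      using lay_start[of n "\<lambda>_ _. 0"] lay_zero start_n by simp
  qed
  moreover have "3 + n < W" using W by (simp add: base_def)
  moreover have "wp W solver P 0 (\<lambda>_. 0) m0" if "wp W matching_phase (wp W (IfLess rC rL (build_splits ;; count_phase ;; round_phase ;; answer) (Const 0 1)) P)
    11 ?r m0" for P
  proof -
    have eleven: "Suc (Suc (Suc (Suc (Suc (Suc (Suc (Suc (Suc (Suc (Suc 0)))))))))) = 11" by simp
    show ?thesis
      using that calculation(2-) k
      by (simp add: solver_def eleven l_def del: wp_IfLess add: wp_IfLess[of W rB rV])
  qed
  ultimately show ?thesis by (simp only: lay_zero)
qed

theorem theorem4:
  "\<exists>p c C. solves_cluster_deletion p c (\<lambda>n l. C * (9 ^ l * l * n + 1))"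
proof (intro exI)
  show "solves_cluster_deletion solver 8 (\<lambda>n l. 2000 * (9 ^ l * l * n + 1))"
    unfolding solves_cluster_deletion_def
  proof (intro allI impI)
    fix n E k adj
    assume G: "simple_graph {..<n} E" and A: "adjacency_lists n E adj"
    let ?l = "card E - k"
    let ?W = "word_bound 8 n k ?l"
    let ?m = "snd (initial_state (input_words n E k adj))"
    let ?Q = "\<lambda>t r m. t \<le> 2000 * (9 ^ ?l * ?l * n + 1) \<and> r 0 = (if cluster_deletion {..<n} E k then 1 else 0)"
    have "wp ?W solver ?Q 0 (\<lambda>_. 0) ?m"
    proof (cases "k < card E")
      case True
      interpret machine_input n E k adj ?W ?l "9 ^ ?l * (n + 1)" "n + 4 + length (concat adj)"
        using G A True length_concat_adjacency[OF G A] word_bound_ge[of ?l n k]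
        by unfold_locales (simp_all only: reflexive, linarith)
      show ?thesis
        unfolding m0_def[symmetric] by (rule wp_solver) simp
    next
      case False
      \<comment> \<open>All edges may be deleted. As \<open>l = 0\<close> here, the product vanishes
        and the summand 1 of the time bound pays for the constant number of steps.\<close>
      then have "cluster_deletion {..<n} E k"
        by (intro cluster_deletion_if_disjoint_cliques[OF G, of "{}"]) simp_all
      moreover have "(2::nat) ^ 8 \<le> (n + k + 2) ^ 8" by (intro power_mono) auto
      then have "3 < ?W" using False by (simp add: word_bound_def)
      moreover have "?m 1 = card E" "?m 2 = k"
        by (simp_all add: initial_state_def input_words_def)
      ultimately show ?thesis
        using False by (simp add: solver_def del: wp_IfLess add: wp_IfLess[of _ rB rV])
    qed
    then obtain t r m where "exec ?W solver ((\<lambda>_. 0), ?m) t (r, m)" "?Q (0 + t) r m"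
      by (rule wpE)
    moreover have "((\<lambda>_. 0), ?m) = initial_state (input_words n E k adj)"
      by (simp add: initial_state_def)
    ultimately show "\<exists>t s. exec ?W solver (initial_state (input_words n E k adj)) t s \<and>
        t \<le> 2000 * (9 ^ ?l * ?l * n + 1) \<and> fst s 0 = (if cluster_deletion {..<n} E k then 1 else 0)"
      by (intro exI[of _ t] exI[of _ "(r, m)"]) simp
  qed
qed

end
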